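(* Let $a,b\in\mathbb{R}$ with $a<b$, let $q\in C([a,b])$ be real-valued and let $p,w\in C^2([a,b])$ be positive functions. Let $\alpha_1,\alpha_2,\beta_1,\beta_2\in\mathbb{R}$ with $\alpha_1^2+\alpha_2^2>0$ and $\beta_1^2+\beta_2^2>0$. Let $\{\phi_n:n\in\mathbb{N}_0\}$ be a complete orthogonal set (in $L^2([a,b],w(x)\,\mathrm{d}x)$) of real eigenfunctions for the regular Sturm--Liouville problem $$\frac{\mathrm{d}}{\mathrm{d}x}\left(p(x)\frac{\mathrm{d}\phi(x)}{\mathrm{d}x}\right)-q(x)\phi(x)=-\lambda w(x)\phi(x),\qquad x\in[a,b],$$ subject to the separated homogeneous boundary conditions $\alpha_1\phi(a)+\alpha_2\phi'(a)=0$ and $\beta_1\phi(b)+\beta_2\phi'(b)=0$, ordered such that the corresponding eigenvalues $\{\lambda_n:n\in\mathbb{N}_0\}$ form a strictly increasing sequence. Then: (i) for $x\in(a,b)$, $$\lim_{N\to\infty}N\sum_{n=N+1}^\infty\frac{(\phi_n(x))^2}{\lambda_n\int_a^b(\phi_n(z))^2w(z)\,\mathrm{d}z}=\frac{1}{\pi^2\sqrt{p(x)w(x)}}\int_a^b\sqrt{\frac{w(z)}{p(z)}}\,\mathrm{d}z;$$ (ii) for $x,y\in[a,b]$ with $x\neq y$, $$\lim_{N\to\infty}N\sum_{n=N+1}^\infty\frac{\phi_n(x)\phi_n(y)}{\lambda_n\int_a^b(\phi_n(z))^2w(z)\,\mathrm{d}z}=0;$$ (iii) at the left endpoint, $$\lim_{N\to\infty}N\sum_{n=N+1}^\infty\frac{(\phi_n(a))^2}{\lambda_n\int_a^b(\phi_n(z))^2w(z)\,\mathrm{d}z}=\begin{cases}\displaystyle\frac{2}{\pi^2\sqrt{p(a)w(a)}}\int_a^b\sqrt{\frac{w(z)}{p(z)}}\,\mathrm{d}z&\text{if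 }\alpha_2\neq0,\\ 0&\text{if }\alpha_2=0;\end{cases}$$ (iv) at the right endpoint, $$\lim_{N\to\infty}N\sum_{n=N+1}^\infty\frac{(\phi_n(b))^2}{\lambda_n\int_a^b(\phi_n(z))^2w(z)\,\mathrm{d}z}=\begin{cases}\displaystyle\frac{2}{\pi^2\sqrt{p(b)w(b)}}\int_a^b\sqrt{\frac{w(z)}{p(z)}}\,\mathrm{d}z&\text{if }\beta_2\neq0,\\ 0&\text{if }\beta_2=0.\end{cases}$$
   Context: $\mathbb{N}_0$ denotes the non-negative integers. An eigenfunction is a non-zero solution $\phi$ of the boundary value problem for some $\lambda$, which is the corresponding eigenvalue. By classical Sturm--Liouville theory such a complete orthogonal set of real eigenfunctions exists and the eigenvalues increase strictly to $+\infty$. A zero eigenvalue is allowed; the sums are considered for $N$ large enough that $\lambda_n\neq 0$ for all $n>N$, which does not affect the limits. *)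

theory Defs
  imports "HOL-Analysis.Analysis"
begin

text \<open>
  Derivatives on a closed interval are taken within the interval, hence are one-sided at the
  endpoints.  They are given as relations; for \<^term>\<open>a < b\<close> the functions whose existence is
  asserted are uniquely determined on \<^term>\<open>{a..b}\<close>.
\<close>

definition C2_on :: "real set \<Rightarrow> (real \<Rightarrow> real) \<Rightarrow> bool" where
  "C2_on S f \<longleftrightarrow> (\<exists>f' f''.
     (\<forall>x\<in>S. (f has_real_derivative f' x) (at x within S)) \<and>
     (\<forall>x\<in>S. (f' has_real_derivative f'' x) (at x within S)) \<and>
     continuous_on S f'')"

text \<open>
  \<^term>\<open>\<psi>\<close> is the derivative of \<^term>\<open>\<lambda>x. p x * \<phi>' x\<close>, so that \<^term>\<open>\<phi>\<close> is a classical
  solution on the closed interval.  Values of \<^term>\<open>\<phi>\<close> outside the interval are irrelevant.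
\<close>

definition sl_solution ::
  "real \<Rightarrow> real \<Rightarrow> (real \<Rightarrow> real) \<Rightarrow> (real \<Rightarrow> real) \<Rightarrow> (real \<Rightarrow> real) \<Rightarrow>
   real \<Rightarrow> real \<Rightarrow> real \<Rightarrow> real \<Rightarrow> real \<Rightarrow> (real \<Rightarrow> real) \<Rightarrow> bool" where
  "sl_solution a b p q w \<alpha>1 \<alpha>2 \<beta>1 \<beta>2 l \<phi> \<longleftrightarrow> (\<exists>\<phi>' \<psi>.
     (\<forall>x\<in>{a..b}. (\<phi> has_real_derivative \<phi>' x) (at x within {a..b})) \<and>
     (\<forall>x\<in>{a..b}. ((\<lambda>t. p t * \<phi>' t) has_real_derivative \<psi> x) (at x within {a..b})) \<and>
     (\<forall>x\<in>{a..b}. \<psi> x - q x * \<phi> x = - l * w x * \<phi> x) \<and>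
     \<alpha>1 * \<phi> a + \<alpha>2 * \<phi>' a = 0 \<and>
     \<beta>1 * \<phi> b + \<beta>2 * \<phi>' b = 0)"

definition sl_eigenfunction ::
  "real \<Rightarrow> real \<Rightarrow> (real \<Rightarrow> real) \<Rightarrow> (real \<Rightarrow> real) \<Rightarrow> (real \<Rightarrow> real) \<Rightarrow>
   real \<Rightarrow> real \<Rightarrow> real \<Rightarrow> real \<Rightarrow> real \<Rightarrow> (real \<Rightarrow> real) \<Rightarrow> bool" where
  "sl_eigenfunction a b p q w \<alpha>1 \<alpha>2 \<beta>1 \<beta>2 l \<phi> \<longleftrightarrow>
     sl_solution a b p q w \<alpha>1 \<alpha>2 \<beta>1 \<beta>2 l \<phi> \<and> (\<exists>x\<in>{a..b}. \<phi> x \<noteq> 0)"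

definition weighted_measure :: "real \<Rightarrow> real \<Rightarrow> (real \<Rightarrow> real) \<Rightarrow> real measure" where
  "weighted_measure a b w = density (lebesgue_on {a..b}) (\<lambda>x. ennreal (w x))"

definition L2_space :: "'a measure \<Rightarrow> ('a \<Rightarrow> real) set" where
  "L2_space M = {f \<in> borel_measurable M. integrable M (\<lambda>x. (f x)\<^sup>2)}"

text \<open>
  Completeness: the finite linear combinations are dense in the (real) space of
  square-integrable functions, with respect to the mean-square norm.
\<close>

definition complete_orthogonal :: "'a measure \<Rightarrow> (nat \<Rightarrow> 'a \<Rightarrow> real) \<Rightarrow> bool" where
  "complete_orthogonal M \<phi> \<longleftrightarrow>
     (\<forall>n. \<phi> n \<in> L2_space M) \<and>
     (\<forall>m n. m \<noteq> n \<longrightarrow> (\<integral>x. \<phi> m x * \<phi> n x \<partial>M) = 0) \<and>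
     (\<forall>f\<in>L2_space M. \<forall>e>0. \<exists>K c.
        sqrt (\<integral>x. (f x - (\<Sum>n<K. c n * \<phi> n x))\<^sup>2 \<partial>M) < e)"

end

theory Submission
  imports Defs
begin

text \<open>
  In the right coordinates the eigenfunctions are asymptotically cosines.  Put
  \<rho> = (p w)^(1/4), \<sigma> = sqrt (w / p), let \<tau> x be the integral of \<sigma> over [a, x], and c = \<tau> b
  (Liouville's transformation).  Then u = \<rho> \<phi> satisfies u'' + (\<lambda> - Q) u = 0 with respect to the
  variable \<tau>, where Q is continuous, with boundary conditions of the same type.  When
  \<lambda> = \<omega>^2 is large, u is, up to a scalar factor and a relative error of order 1 / \<omega>, the function
  cos (\<omega> \<tau> - \<theta>0), where \<theta>0 = 0 for a condition involving the derivative at a and \<theta>0 = \<pi> / 2 for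
  \<phi> a = 0.  The condition at b forces \<omega> c \<approx> k \<pi> + \<theta>0 + \<theta>1 with an integer k, where \<theta>1 encodes the
  condition at b in the same way; write \<kappa> k = (k \<pi> + \<theta>0 + \<theta>1) / c.

  If the integer belonging to the n-th eigenvalue is n + s for a fixed s and all large n, then
  \<lambda> n \<sim> (n \<pi> / c)^2 and, with \<kappa> = \<kappa> (n + s), the product u n x * u n y divided by the squared norm of
  u n differs by o(1) from
  (cos (\<kappa> (\<tau> x - \<tau> y)) + cos (\<kappa> (\<tau> x + \<tau> y) - 2 \<theta>0)) / c.
  As the numbers \<kappa> k form an arithmetic progression, each cosine has Cesaro mean 0 over n, except in the
  resonant cases: x = y for the first, and x = y at an end of the interval for the second, with mean
  cos (2 \<theta>0) at a and cos (2 \<theta>1) at b, that is, 1 or -1.  A sequence with Cesaro mean L, divided by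
  n^2 and summed over n > N, gives L / N + o(1 / N) by summation by parts (\<open>cesaro_tail_limit\<close>).  This yields all four limits (\<open>spectral_tail\<close>).

  It remains to see that the integers run through consecutive values.  No integer is taken by two large
  eigenvalues, since both eigenfunctions would be close to the same cosine and could not be orthogonal
  (\<open>idx_eventually_injective\<close>).  No large integer k is skipped (\<open>idx_eventually_consecutive\<close>): the
  cosine with frequency \<kappa> k, corrected so as to satisfy the boundary conditions, solves the equation
  for \<lambda> = (\<kappa> k)^2 up to a bounded error, and for a complete orthogonal system this forces an
  eigenvalue at bounded distance from (\<kappa> k)^2 (\<open>spectral_gap\<close>, \<open>eigenvalue_near_\<kappa>_square\<close>).  The
  argument leaves s undetermined, but a shift changes neither Cesaro means nor the growth of the
  eigenvalues.
\<close>

section \<open>Tails of series whose terms have a Cesaro mean\<close>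

text \<open>
  The part of t that telescopes contributes exactly T (N + 1) to the tail; the rest is o(1) times the
  telescoping series of 1 / n and contributes o(1 / N).
\<close>

lemma telescoping_tail_limit:
  fixes t T e :: "nat \<Rightarrow> real"
  assumes t: "\<And>n. n \<ge> n0 \<Longrightarrow> t n = T n - T (Suc n) + e n * (1 / real n - 1 / real (Suc n))"
    and T: "(\<lambda>n. real n * T n) \<longlonglongrightarrow> L" and e: "e \<longlonglongrightarrow> 0"
  shows "summable t" and "(\<lambda>N. real N * (\<Sum>k. t (N + 1 + k))) \<longlonglongrightarrow> L"
proof -
  have inv0: "(\<lambda>n. 1 / real n) \<longlonglongrightarrow> 0"
    by (rule lim_1_over_n)
  have "(\<lambda>n. (real n * T n) * (1 / real n)) \<longlonglongrightarrow> L * 0"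
    by (intro tendsto_mult T inv0)
  moreover have "eventually (\<lambda>n. (real n * T n) * (1 / real n) = T n) sequentially"
    using eventually_gt_at_top[of 0] by eventually_elim auto
  ultimately have T0: "T \<longlonglongrightarrow> 0"
    by (simp add: tendsto_cong)
  define d where "d n = 1 / real n - 1 / real (Suc n)" for n :: nat
  have d_nonneg: "d n \<ge> 0" if "n > 0" for n
    using that by (simp add: d_def field_simps)
  have shift: "filterlim (\<lambda>k. m + k) sequentially sequentially" for m :: nat
    using filterlim_add_const_nat_at_top[of m] by (simp add: add.commute)
  have sums_d: "(\<lambda>k. d (m + k)) sums (1 / real m)" for m
  proof -
    have "(\<lambda>k. 1 / real (m + k)) \<longlonglongrightarrow> 0"
      using filterlim_compose[OF inv0 shift] .
    from telescope_sums'[OF this] show ?thesis by (simp add: d_def)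
  qed
  have sums_T: "(\<lambda>k. T (m + k) - T (Suc (m + k))) sums T m" for m
  proof -
    have "(\<lambda>k. T (m + k)) \<longlonglongrightarrow> 0"
      using filterlim_compose[OF T0 shift] .
    from telescope_sums'[OF this] show ?thesis by simp
  qed
  obtain n1 where n1: "\<And>n. n \<ge> n1 \<Longrightarrow> \<bar>e n\<bar> < 1"
    using LIMSEQ_D[OF e, of 1] by auto
  have summ_ed: "summable (\<lambda>k. e (m + k) * d (m + k))" if m: "m \<ge> n1" "m > 0" for m
  proof (rule summable_comparison_test')
    show "summable (\<lambda>k. d (m + k))" using sums_d sums_summable by blast
    fix k :: nat
    have "\<bar>e (m + k)\<bar> * \<bar>d (m + k)\<bar> \<le> 1 * d (m + k)"
      using n1[of "m + k"] d_nonneg[of "m + k"] m by (intro mult_mono) auto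
    then show "norm (e (m + k) * d (m + k)) \<le> d (m + k)"
      by (simp add: abs_mult)
  qed
  have t_shift: "t (m + k) = T (m + k) - T (Suc (m + k)) + e (m + k) * d (m + k)"
    if "m \<ge> n0" for m k
    using t[of "m + k"] that by (simp add: d_def)
  have summ_t: "summable (\<lambda>k. t (m + k))" if "m \<ge> n0" "m \<ge> n1" "m > 0" for m
  proof -
    have "summable (\<lambda>k. (T (m + k) - T (Suc (m + k))) + e (m + k) * d (m + k))"
      using that by (intro summable_add sums_summable[OF sums_T] summ_ed)
    then show ?thesis using t_shift that by simp
  qed
  have "summable (\<lambda>k. t (k + (n0 + n1 + 1)))"
    using summ_t[of "n0 + n1 + 1"] by (simp add: add.commute)
  then show "summable t" by (simp only: summable_iff_shift)
  have sum_t: "(\<Sum>k. t (m + k)) = T m + (\<Sum>k. e (m + k) * d (m + k))"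
    if "m \<ge> n0" "m \<ge> n1" "m > 0" for m
  proof -
    have "(\<Sum>k. t (m + k)) = (\<Sum>k. (T (m + k) - T (Suc (m + k))) + e (m + k) * d (m + k))"
      using t_shift that by simp
    also have "\<dots> = (\<Sum>k. T (m + k) - T (Suc (m + k))) + (\<Sum>k. e (m + k) * d (m + k))"
      using that by (intro suminf_add[symmetric] sums_summable[OF sums_T] summ_ed)
    finally show ?thesis using sums_unique[OF sums_T[of m]] by simp
  qed
  have rest: "(\<lambda>m. real m * (\<Sum>k. e (m + k) * d (m + k))) \<longlonglongrightarrow> 0"
  proof (rule LIMSEQ_I)
    fix \<epsilon> :: real assume "\<epsilon> > 0"
    then obtain n2 where n2: "\<And>n. n \<ge> n2 \<Longrightarrow> \<bar>e n\<bar> < \<epsilon> / 2"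
      using LIMSEQ_D[OF e, of "\<epsilon> / 2"] by auto
    show "\<exists>no. \<forall>m\<ge>no. norm (real m * (\<Sum>k. e (m + k) * d (m + k)) - 0) < \<epsilon>"
    proof (intro exI allI impI)
      fix m assume m: "m \<ge> n1 + n2 + 1"
      have ab: "\<bar>e (m + k) * d (m + k)\<bar> \<le> \<epsilon> / 2 * d (m + k)" for k
        unfolding abs_mult using n2[of "m + k"] d_nonneg[of "m + k"] m
        by (intro mult_mono) auto
      have sd: "(\<lambda>k. \<epsilon> / 2 * d (m + k)) sums (\<epsilon> / 2 * (1 / real m))"
        by (intro sums_mult sums_d)
      have "\<bar>\<Sum>k. e (m + k) * d (m + k)\<bar> \<le> (\<Sum>k. \<epsilon> / 2 * d (m + k))"
        using ab by (intro norm_suminf_le[where 'a = real, simplified] sums_summable[OF sd]) auto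
      also have "\<dots> = \<epsilon> / 2 / real m" using sums_unique[OF sd] by simp
      finally have "real m * \<bar>\<Sum>k. e (m + k) * d (m + k)\<bar> \<le> real m * (\<epsilon> / 2 / real m)"
        by (rule mult_left_mono) simp
      then show "norm (real m * (\<Sum>k. e (m + k) * d (m + k)) - 0) < \<epsilon>"
        using m \<open>\<epsilon> > 0\<close> by (simp add: abs_mult)
    qed
  qed
  have "(\<lambda>m. real m * (\<Sum>k. t (m + k))) \<longlonglongrightarrow> L + 0"
  proof (rule Lim_transform_eventually[OF tendsto_add[OF T rest]])
    show "\<forall>\<^sub>F m in sequentially. real m * T m + real m * (\<Sum>k. e (m + k) * d (m + k))
        = real m * (\<Sum>k. t (m + k))"
      using eventually_ge_at_top[of "n0 + n1 + 1"]
      by eventually_elim (simp add: sum_t algebra_simps)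
  qed
  then have A: "(\<lambda>N. real (Suc N) * (\<Sum>k. t (Suc N + k))) \<longlonglongrightarrow> L"
    using LIMSEQ_Suc by force
  have B: "(\<lambda>N. real N / real (Suc N)) \<longlonglongrightarrow> 1"
    by (rule LIMSEQ_n_over_Suc_n)
  have "(\<lambda>N. (real N / real (Suc N)) * (real (Suc N) * (\<Sum>k. t (Suc N + k)))) \<longlonglongrightarrow> 1 * L"
    by (intro tendsto_mult A B)
  moreover have "(real N / real (Suc N)) * (real (Suc N) * (\<Sum>k. t (Suc N + k)))
      = real N * (\<Sum>k. t (N + 1 + k))" for N
    by simp
  ultimately show "(\<lambda>N. real N * (\<Sum>k. t (N + 1 + k))) \<longlonglongrightarrow> L"
    by simp
qed

text \<open>
  Summation by parts with the partial sums S n of s: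
  s n / n^2 = S (n+1) / (n+1)^2 - S n / n^2 + S (n+1) (1 / n^2 - 1 / (n+1)^2).  As S n \<approx> L n, the last
  summand is (2 L + o(1)) (1 / n - 1 / (n+1)), so that the tail is
  - S (N+1) / (N+1)^2 + (2 L + o(1)) / N = (L + o(1)) / N.  The terms t n have to agree with s n / n^2
  only up to o(1 / n^2), which absorbs the errors in the asymptotics of eigenvalues and eigenfunctions.
\<close>

lemma cesaro_tail_limit:
  fixes t s :: "nat \<Rightarrow> real"
  assumes mean: "(\<lambda>N. (\<Sum>n<N. s n) / real N) \<longlonglongrightarrow> L"
    and t: "(\<lambda>n. t n * (real n)\<^sup>2 - s n) \<longlonglongrightarrow> 0"
  shows "summable t" and "(\<lambda>N. real N * (\<Sum>k. t (N + 1 + k))) \<longlonglongrightarrow> L"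
proof -
  define S where "S N = (\<Sum>n<N. s n)" for N
  define T where "T n = (2 * L - S n / real n) / real n" for n
  define e where "e n = (t n * (real n)\<^sup>2 - s n) * (1 + 1 / real n)
      + S (Suc n) / real (Suc n) * (2 + 1 / real n) - 2 * L" for n
  have inv0: "(\<lambda>n. 1 / real n) \<longlonglongrightarrow> 0" by (rule lim_1_over_n)
  have e0: "e \<longlonglongrightarrow> 0 * (1 + 0) + L * (2 + 0) - 2 * L"
    unfolding e_def using LIMSEQ_Suc[OF mean]
    by (intro tendsto_intros inv0 t) (auto simp: S_def)
  have T: "(\<lambda>n. real n * T n) \<longlonglongrightarrow> L"
  proof (rule Lim_transform_eventually)
    show "(\<lambda>n. 2 * L - S n / real n) \<longlonglongrightarrow> L"
      using tendsto_diff[OF tendsto_const[of "2 * L"] mean] by (simp add: S_def)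
    show "\<forall>\<^sub>F n in sequentially. 2 * L - S n / real n = real n * T n"
      using eventually_gt_at_top[of 0] by eventually_elim (simp add: T_def)
  qed
  have eq: "t n = T n - T (Suc n) + e n * (1 / real n - 1 / real (Suc n))" if "n \<ge> 1" for n
  proof -
    have s: "s n = S (Suc n) - S n" by (simp add: S_def)
    have gen: "\<tau> = (2 * L - x / y) / y - (2 * L - x' / (y + 1)) / (y + 1)
      + ((\<tau> * y\<^sup>2 - (x' - x)) * (1 + 1 / y) + x' / (y + 1) * (2 + 1 / y) - 2 * L)
        * (1 / y - 1 / (y + 1))" if "y > 0" for \<tau> x x' y :: real
    proof -
      have nz: "y \<noteq> 0" "y + 1 \<noteq> 0" using that by auto
      have d: "1 / y - 1 / (y + 1) = 1 / (y * (y + 1))" using nz by (simp add: field_simps)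
      show ?thesis unfolding d using nz
        by (simp add: divide_simps) (simp add: algebra_simps power2_eq_square)
    qed
    have y: "real (Suc n) = real n + 1" by simp
    show ?thesis unfolding T_def e_def s y by (rule gen) (use that in simp)
  qed
  from telescoping_tail_limit[OF eq T] e0
  show "summable t" and "(\<lambda>N. real N * (\<Sum>k. t (N + 1 + k))) \<longlonglongrightarrow> L"
    by simp_all
qed

text \<open>
  Away from resonance the partial sums stay bounded: each summand is a difference of consecutive values of
  sin ((n - 1/2) \<theta> + \<gamma>) / (2 sin (\<theta> / 2)).
\<close>

lemma cesaro_cos_arithmetic:
  fixes \<theta> \<gamma> :: real
  assumes "sin (\<theta> / 2) \<noteq> 0"
  shows "(\<lambda>N. (\<Sum>n<N. cos (real n * \<theta> + \<gamma>)) / real N) \<longlonglongrightarrow> 0"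
proof -
  define S where "S n = sin (real n * \<theta> - \<theta> / 2 + \<gamma>) / (2 * sin (\<theta> / 2))" for n
  have step: "S (Suc n) - S n = cos (real n * \<theta> + \<gamma>)" for n
  proof -
    have e: "real (Suc n) * \<theta> - \<theta> / 2 + \<gamma> = (real n * \<theta> + \<gamma>) + \<theta> / 2"
        "real n * \<theta> - \<theta> / 2 + \<gamma> = (real n * \<theta> + \<gamma>) - \<theta> / 2" by (simp_all add: algebra_simps)
    show ?thesis unfolding S_def e sin_add sin_diff using assms
      by (simp add: field_simps)
  qed
  have sum: "(\<Sum>n<N. cos (real n * \<theta> + \<gamma>)) = S N - S 0" for N
    by (induction N) (simp_all add: step[symmetric])
  have bd: "\<bar>S n\<bar> \<le> 1 / \<bar>2 * sin (\<theta> / 2)\<bar>" for n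
    using assms by (simp add: S_def abs_mult abs_divide divide_right_mono)
  have "(\<lambda>N. (S N - S 0) * (1 / real N)) \<longlonglongrightarrow> 0"
  proof (rule lim_null_mult_left_bounded[where B = "2 / \<bar>2 * sin (\<theta> / 2)\<bar>"])
    show "(\<lambda>N. 1 / real N) \<longlonglongrightarrow> 0" by (rule lim_1_over_n)
    show "\<forall>\<^sub>F N in sequentially. norm (S N - S 0) \<le> 2 / \<bar>2 * sin (\<theta> / 2)\<bar>"
    proof (intro always_eventually allI)
      fix N
      have "\<bar>S N - S 0\<bar> \<le> \<bar>S N\<bar> + \<bar>S 0\<bar>" by (rule abs_triangle_ineq4)
      also have "\<dots> \<le> 2 / \<bar>2 * sin (\<theta> / 2)\<bar>" using bd[of N] bd[of 0] by simp
      finally show "norm (S N - S 0) \<le> 2 / \<bar>2 * sin (\<theta> / 2)\<bar>" by simp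
    qed
  qed
  then show ?thesis by (simp add: sum)
qed

lemma cesaro_const: "(\<lambda>N. (\<Sum>n<N. L) / real N) \<longlonglongrightarrow> (L::real)"
proof (rule Lim_transform_eventually[OF tendsto_const])
  show "\<forall>\<^sub>F N in sequentially. L = (\<Sum>n<N. L) / real N"
    using eventually_gt_at_top[of 0] by eventually_elim simp
qed

section \<open>Self-adjoint systems in Liouville normal form\<close>

text \<open>
  The equation u'' + (\<lambda> - Q) u = 0 in the variable \<tau>, written as a first-order system on the original
  interval: v is the derivative of u with respect to \<tau>, and R = \<sigma> Q.  Keeping the original variable
  turns the change of variables into the weight \<sigma> in every integral.  The phase at an end is 0 for a
  condition v = h u and \<pi> / 2 for u = 0; in the second case h is set to 0, which lets one formula for the
  approximate eigenfunctions cover both.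
\<close>

locale liouville_form =
  fixes a b :: real and \<sigma> R \<tau> :: "real \<Rightarrow> real" and h H \<theta>0 \<theta>1 :: real
    and ev :: "nat \<Rightarrow> real" and u v :: "nat \<Rightarrow> real \<Rightarrow> real"
  assumes ab: "a < b"
    and \<sigma>_cont: "continuous_on {a..b} \<sigma>" and \<sigma>_pos: "\<And>x. x \<in> {a..b} \<Longrightarrow> \<sigma> x > 0"
    and R_cont: "continuous_on {a..b} R"
    and \<tau>_deriv: "\<And>x. x \<in> {a..b} \<Longrightarrow> (\<tau> has_real_derivative \<sigma> x) (at x within {a..b})"
    and \<tau>_left: "\<tau> a = 0"
    and u_deriv: "\<And>n x. x \<in> {a..b} \<Longrightarrow> (u n has_real_derivative \<sigma> x * v n x) (at x within {a..b})"
    and v_deriv: "\<And>n x. x \<in> {a..b} \<Longrightarrow>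
      (v n has_real_derivative (R x - ev n * \<sigma> x) * u n x) (at x within {a..b})"
    and bc_left: "\<And>n. \<theta>0 = 0 \<and> v n a = h * u n a \<or> \<theta>0 = pi / 2 \<and> h = 0 \<and> u n a = 0"
    and bc_right: "\<And>n. \<theta>1 = 0 \<and> v n b = H * u n b \<or> \<theta>1 = pi / 2 \<and> H = 0 \<and> u n b = 0"
    and nontrivial: "\<And>n. \<exists>x\<in>{a..b}. u n x \<noteq> 0"
    and ev_mono: "strict_mono ev"
    and orthogonal: "\<And>m n. m \<noteq> n \<Longrightarrow> integral {a..b} (\<lambda>x. u m x * u n x * \<sigma> x) = 0"
    and complete: "\<And>f e. continuous_on {a..b} f \<Longrightarrow> e > 0 \<Longrightarrow>
      \<exists>K c. integral {a..b} (\<lambda>x. (f x - (\<Sum>n<K. c n * u n x))\<^sup>2 * \<sigma> x) < e"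
begin

definition c :: real where "c = \<tau> b"

definition ip :: "(real \<Rightarrow> real) \<Rightarrow> (real \<Rightarrow> real) \<Rightarrow> real" where
  "ip f g = integral {a..b} (\<lambda>x. f x * g x * \<sigma> x)"

lemma ends: "a \<in> {a..b}" "b \<in> {a..b}"
  using ab by auto

lemma u_cont: "continuous_on {a..b} (u n)"
  by (rule DERIV_continuous_on[OF u_deriv])

lemma \<tau>_cont: "continuous_on {a..b} \<tau>"
  by (rule DERIV_continuous_on[OF \<tau>_deriv])

lemma has_integral_\<sigma>: "(\<sigma> has_integral c) {a..b}"
  using fundamental_theorem_of_calculus[of a b \<tau> \<sigma>] ab \<tau>_deriv \<tau>_left
  by (simp add: has_real_derivative_iff_has_vector_derivative c_def)

lemma weighted_integrable:
  "continuous_on {a..b} f \<Longrightarrow> (\<lambda>x. f x * \<sigma> x) integrable_on {a..b}"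
  by (intro integrable_continuous_interval continuous_intros \<sigma>_cont)

lemma ip_integrable:
  "continuous_on {a..b} f \<Longrightarrow> continuous_on {a..b} g \<Longrightarrow> (\<lambda>x. f x * g x * \<sigma> x) integrable_on {a..b}"
  by (intro integrable_continuous_interval continuous_intros \<sigma>_cont)

lemma weighted_integral_bound:
  assumes f: "continuous_on {a..b} f" and B: "\<And>x. x \<in> {a..b} \<Longrightarrow> \<bar>f x\<bar> \<le> B"
  shows "\<bar>integral {a..b} (\<lambda>x. f x * \<sigma> x)\<bar> \<le> B * c"
proof -
  have "norm (integral {a..b} (\<lambda>x. f x * \<sigma> x)) \<le> integral {a..b} (\<lambda>x. B * \<sigma> x)"
  proof (rule integral_norm_bound_integral)
    show "(\<lambda>x. B * \<sigma> x) integrable_on {a..b}" by (rule weighted_integrable) (rule continuous_on_const)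
    fix x assume x: "x \<in> {a..b}"
    show "norm (f x * \<sigma> x) \<le> B * \<sigma> x"
      using B[OF x] \<sigma>_pos[OF x] by (simp add: abs_mult mult_right_mono)
  qed (rule weighted_integrable[OF f])
  also have "\<dots> = B * c"
    using has_integral_\<sigma> by (simp add: integral_unique)
  finally show ?thesis by simp
qed

lemma weighted_integral_ge:
  assumes f: "continuous_on {a..b} f" and B: "\<And>x. x \<in> {a..b} \<Longrightarrow> B \<le> f x"
  shows "B * c \<le> integral {a..b} (\<lambda>x. f x * \<sigma> x)"
proof -
  have "B * c = integral {a..b} (\<lambda>x. B * \<sigma> x)"
    using has_integral_\<sigma> by (simp add: integral_unique)
  also have "\<dots> \<le> integral {a..b} (\<lambda>x. f x * \<sigma> x)"
  proof (rule integral_le)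
    show "(\<lambda>x. B * \<sigma> x) integrable_on {a..b}" by (rule weighted_integrable) (rule continuous_on_const)
    show "(\<lambda>x. f x * \<sigma> x) integrable_on {a..b}" by (rule weighted_integrable[OF f])
    show "B * \<sigma> x \<le> f x * \<sigma> x" if "x \<in> {a..b}" for x
      using B[OF that] \<sigma>_pos[OF that] by (simp add: mult_right_mono)
  qed
  finally show ?thesis .
qed

lemma c_pos: "c > 0"
proof -
  have "\<exists>x\<in>{a<..<b}. \<tau> b - \<tau> a = \<sigma> x * (b - a)"
    by (rule mvt_simple[OF ab]) (use \<tau>_deriv in \<open>auto simp: has_field_derivative_def\<close>)
  then obtain x where "x \<in> {a<..<b}" "c = \<sigma> x * (b - a)"
    by (auto simp: c_def \<tau>_left)
  then show ?thesis using \<sigma>_pos[of x] ab by simp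
qed

lemma \<tau>_range:
  assumes "x \<in> {a..b}"
  shows "0 \<le> \<tau> x" "\<tau> x \<le> c"
proof -
  have mono: "\<tau> y \<le> \<tau> z" if "a \<le> y" "y \<le> z" "z \<le> b" for y z
  proof (rule DERIV_nonneg_imp_increasing_open[OF \<open>y \<le> z\<close>])
    show "\<exists>D. (\<tau> has_real_derivative D) (at t) \<and> 0 \<le> D" if "y < t" "t < z" for t
    proof (intro exI conjI)
      have t: "t \<in> {a<..<b}" using that \<open>a \<le> y\<close> \<open>z \<le> b\<close> by auto
      show "(\<tau> has_real_derivative \<sigma> t) (at t)"
        using \<tau>_deriv[of t] t at_within_Icc_at[of a t b] by auto
      show "0 \<le> \<sigma> t" using \<sigma>_pos[of t] t by auto
    qed
    show "continuous_on {y..z} \<tau>"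
      using \<tau>_cont by (rule continuous_on_subset) (use that in auto)
  qed
  show "0 \<le> \<tau> x" "\<tau> x \<le> c"
    using mono[of a x] mono[of x b] assms by (auto simp: \<tau>_left c_def)
qed

lemma \<tau>_strict:
  assumes "x \<in> {a..b}" "y \<in> {a..b}" "x < y"
  shows "\<tau> x < \<tau> y"
proof -
  have "\<exists>z\<in>{x<..<y}. \<tau> y - \<tau> x = \<sigma> z * (y - x)"
  proof (rule mvt_simple[OF \<open>x < y\<close>])
    fix t assume "x \<le> t" "t \<le> y"
    then have "(\<tau> has_real_derivative \<sigma> t) (at t within {x..y})"
      using assms by (intro has_field_derivative_subset[OF \<tau>_deriv]) auto
    then show "(\<tau> has_derivative (*) (\<sigma> t)) (at t within {x..y})"
      by (simp add: has_field_derivative_def)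
  qed
  then obtain z where "z \<in> {x<..<y}" "\<tau> y - \<tau> x = \<sigma> z * (y - x)" by blast
  moreover from this have "\<sigma> z * (y - x) > 0" using assms by (intro mult_pos_pos \<sigma>_pos) auto
  ultimately show ?thesis by simp
qed

lemma ip_nonneg: "ip f f \<ge> 0"
  unfolding ip_def
  by (cases "(\<lambda>x. f x * f x * \<sigma> x) integrable_on {a..b}")
    (auto simp: not_integrable_integral intro!: integral_nonneg mult_nonneg_nonneg[OF zero_le_square less_imp_le[OF \<sigma>_pos]])

lemma ip_self_pos:
  assumes f: "continuous_on {a..b} f" and nz: "\<exists>x\<in>{a..b}. f x \<noteq> 0"
  shows "ip f f > 0"
proof (rule ccontr)
  assume "\<not> ip f f > 0"
  then have 0: "integral {a..b} (\<lambda>x. f x * f x * \<sigma> x) = 0"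
    using ip_nonneg[of f] by (simp add: ip_def)
  have cont: "continuous_on (cbox a b) (\<lambda>x. f x * f x * \<sigma> x)"
    using f \<sigma>_cont by (auto intro!: continuous_intros)
  have "((\<lambda>x. f x * f x * \<sigma> x) has_integral 0) (cbox a b)"
    using ip_integrable[OF f f] 0 by (simp add: has_integral_integral)
  then have "f x * f x * \<sigma> x = 0" if "x \<in> {a..b}" for x
    using has_integral_0_cbox_imp_0[OF cont _ _ _ , of x] that ab \<sigma>_pos
    by (auto simp: less_imp_le)
  with nz \<sigma>_pos show False by force
qed

text \<open>
  Orthogonality removes the mixed terms: in the step from K to K + 1 the new eigenfunction is orthogonal
  to the combination of the earlier ones.
\<close>

lemma ip_combination:
  assumes f: "continuous_on {a..b} f"
  shows "integral {a..b} (\<lambda>x. (f x - (\<Sum>n<K. d n * u n x))\<^sup>2 * \<sigma> x)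
    = ip f f - 2 * (\<Sum>n<K. d n * ip f (u n)) + (\<Sum>n<K. (d n)\<^sup>2 * ip (u n) (u n))"
proof (induction K)
  case 0
  show ?case by (simp add: ip_def power2_eq_square)
next
  case (Suc K)
  define g where "g x = (\<Sum>n<K. d n * u n x)" for x
  have g: "continuous_on {a..b} g"
    unfolding g_def by (intro continuous_intros u_cont)
  have gu: "ip g (u K) = 0"
  proof -
    have "ip g (u K) = integral {a..b} (\<lambda>x. \<Sum>n<K. d n * (u n x * u K x * \<sigma> x))"
      by (simp add: ip_def g_def sum_distrib_right mult.assoc)
    also have "\<dots> = (\<Sum>n<K. integral {a..b} (\<lambda>x. d n * (u n x * u K x * \<sigma> x)))"
      by (intro integral_sum integrable_on_mult_right ip_integrable u_cont) auto
    also have "\<dots> = 0" by (intro sum.neutral) (auto simp: orthogonal)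
    finally show ?thesis .
  qed
  have "integral {a..b} (\<lambda>x. (f x - (\<Sum>n<Suc K. d n * u n x))\<^sup>2 * \<sigma> x)
      = integral {a..b} (\<lambda>x. ((f x - g x)\<^sup>2 * \<sigma> x + (- 2 * d K) * (f x * u K x * \<sigma> x))
          + ((2 * d K) * (g x * u K x * \<sigma> x) + (d K)\<^sup>2 * (u K x * u K x * \<sigma> x)))"
    by (intro integral_cong) (simp add: g_def[symmetric] algebra_simps power2_eq_square)
  also have "\<dots> = (integral {a..b} (\<lambda>x. (f x - g x)\<^sup>2 * \<sigma> x) + (- 2 * d K) * ip f (u K))
          + ((2 * d K) * ip g (u K) + (d K)\<^sup>2 * ip (u K) (u K))"
    unfolding ip_def
    by (subst integral_add integral_mult_right, 
        (intro integrable_add integrable_on_mult_right weighted_integrable ip_integrable continuous_intros f g u_cont)+)+ simp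
  finally show ?case using Suc gu by (simp add: g_def algebra_simps)
qed

lemma norm_u_pos: "ip (u n) (u n) > 0"
  by (rule ip_self_pos[OF u_cont nontrivial])

lemma bessel:
  assumes f: "continuous_on {a..b} f"
  shows "(\<Sum>n<K. (ip f (u n))\<^sup>2 / ip (u n) (u n)) \<le> ip f f"
proof -
  define d where "d n = ip f (u n) / ip (u n) (u n)" for n
  have "0 \<le> integral {a..b} (\<lambda>x. (f x - (\<Sum>n<K. d n * u n x))\<^sup>2 * \<sigma> x)"
    using ip_nonneg[of "\<lambda>x. f x - (\<Sum>n<K. d n * u n x)"] by (simp add: ip_def power2_eq_square)
  also have "\<dots> = ip f f - 2 * (\<Sum>n<K. d n * ip f (u n)) + (\<Sum>n<K. (d n)\<^sup>2 * ip (u n) (u n))"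
    by (rule ip_combination[OF f])
  also have "(\<Sum>n<K. d n * ip f (u n)) = (\<Sum>n<K. (ip f (u n))\<^sup>2 / ip (u n) (u n))"
    by (simp add: d_def power2_eq_square)
  also have "(\<Sum>n<K. (d n)\<^sup>2 * ip (u n) (u n)) = (\<Sum>n<K. (ip f (u n))\<^sup>2 / ip (u n) (u n))"
    using norm_u_pos by (intro sum.cong) (auto simp: d_def power2_eq_square less_imp_neq[symmetric])
  finally show ?thesis by simp
qed

text \<open>
  Among all coefficients, the quotients ip f (u n) / ip (u n) (u n) give the best approximation, so density of
  the linear combinations bounds ip f f by the Fourier coefficients.
\<close>

lemma parseval_le:
  assumes f: "continuous_on {a..b} f" and e: "e > 0"
  shows "\<exists>K. ip f f \<le> (\<Sum>n<K. (ip f (u n))\<^sup>2 / ip (u n) (u n)) + e"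
proof -
  obtain K d where Kd: "integral {a..b} (\<lambda>x. (f x - (\<Sum>n<K. d n * u n x))\<^sup>2 * \<sigma> x) < e"
    using complete[OF f e] by blast
  have "2 * (d n * ip f (u n)) - (d n)\<^sup>2 * ip (u n) (u n) \<le> (ip f (u n))\<^sup>2 / ip (u n) (u n)" for n
  proof -
    have "0 \<le> (d n * ip (u n) (u n) - ip f (u n))\<^sup>2" by simp
    then have "(2 * (d n * ip f (u n)) - (d n)\<^sup>2 * ip (u n) (u n)) * ip (u n) (u n) \<le> (ip f (u n))\<^sup>2"
      by (simp add: algebra_simps power2_eq_square)
    then show ?thesis using norm_u_pos[of n] by (simp add: pos_le_divide_eq)
  qed
  then have "(\<Sum>n<K. 2 * (d n * ip f (u n)) - (d n)\<^sup>2 * ip (u n) (u n))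
      \<le> (\<Sum>n<K. (ip f (u n))\<^sup>2 / ip (u n) (u n))"
    by (intro sum_mono)
  then have "ip f f \<le> (\<Sum>n<K. (ip f (u n))\<^sup>2 / ip (u n) (u n)) + e"
    using Kd unfolding ip_combination[OF f] by (simp add: sum_subtractf sum_distrib_left)
  then show ?thesis ..
qed

text \<open>
  The norm of the resolvent is the reciprocal of the distance to the spectrum.  Here g plays the role of
  (\<mu> - A) f for the operator A with eigenvalues ev n and eigenfunctions u n; the hypothesis \<open>fg\<close>
  expresses this through the Fourier coefficients.
\<close>

lemma spectral_gap:
  assumes f: "continuous_on {a..b} f" and g: "continuous_on {a..b} g"
    and fg: "\<And>n. (\<mu> - ev n) * ip f (u n) = ip g (u n)"
    and gap: "\<And>n. \<bar>ev n - \<mu>\<bar> \<ge> G" and G: "G > 0"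
  shows "G\<^sup>2 * ip f f \<le> ip g g"
proof (rule field_le_epsilon)
  fix e :: real assume "e > 0"
  then obtain K where K: "ip f f \<le> (\<Sum>n<K. (ip f (u n))\<^sup>2 / ip (u n) (u n)) + e / G\<^sup>2"
    using parseval_le[OF f, of "e / G\<^sup>2"] G by auto
  have "G\<^sup>2 * ((ip f (u n))\<^sup>2 / ip (u n) (u n)) \<le> (ip g (u n))\<^sup>2 / ip (u n) (u n)" for n
  proof -
    have "G\<^sup>2 \<le> (\<mu> - ev n)\<^sup>2"
      using gap[of n] G by (intro abs_le_square_iff[THEN iffD1]) auto
    then have "G\<^sup>2 * (ip f (u n))\<^sup>2 \<le> (\<mu> - ev n)\<^sup>2 * (ip f (u n))\<^sup>2"
      by (rule mult_right_mono) simp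
    also have "\<dots> = (ip g (u n))\<^sup>2" by (simp add: fg[symmetric] power_mult_distrib)
    finally show ?thesis using norm_u_pos[of n] by (simp add: divide_right_mono)
  qed
  then have "G\<^sup>2 * (\<Sum>n<K. (ip f (u n))\<^sup>2 / ip (u n) (u n)) \<le> (\<Sum>n<K. (ip g (u n))\<^sup>2 / ip (u n) (u n))"
    unfolding sum_distrib_left by (intro sum_mono)
  also have "\<dots> \<le> ip g g" by (rule bessel[OF g])
  finally have 1: "G\<^sup>2 * (\<Sum>n<K. (ip f (u n))\<^sup>2 / ip (u n) (u n)) \<le> ip g g" .
  have "G\<^sup>2 * ip f f \<le> G\<^sup>2 * ((\<Sum>n<K. (ip f (u n))\<^sup>2 / ip (u n) (u n)) + e / G\<^sup>2)"
    using K by (rule mult_left_mono) simp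
  also have "\<dots> \<le> ip g g + e" using 1 G by (simp add: distrib_left)
  finally show "G\<^sup>2 * ip f f \<le> ip g g + e" .
qed

end

section \<open>Eigenfunctions for large eigenvalues\<close>

text \<open>
  The logarithmic derivative of the energy U^2 + (V / \<omega>)^2 is at most M / \<omega>: the large terms with
  \<omega>^2 \<sigma> cancel and only 2 (R / \<omega>) U (V / \<omega>) remains.
\<close>

lemma exponential_energy_bound:
  fixes \<sigma> R U V :: "real \<Rightarrow> real"
  assumes U: "\<And>x. x \<in> {a..b} \<Longrightarrow> (U has_real_derivative \<sigma> x * V x) (at x within {a..b})"
    and V: "\<And>x. x \<in> {a..b} \<Longrightarrow>
      (V has_real_derivative (R x - \<omega>\<^sup>2 * \<sigma> x) * U x) (at x within {a..b})"
    and M: "\<And>x. x \<in> {a..b} \<Longrightarrow> \<bar>R x\<bar> \<le> M" and \<omega>: "\<omega> \<ge> 1" and x: "x \<in> {a..b}"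
  shows "(U x)\<^sup>2 + (V x / \<omega>)\<^sup>2 \<le> ((U a)\<^sup>2 + (V a / \<omega>)\<^sup>2) * exp (M * (b - a))"
proof -
  define E where "E t = (U t)\<^sup>2 + (V t / \<omega>)\<^sup>2" for t
  define Z where "Z t = E t * exp (- (M / \<omega>) * (t - a))" for t
  define Z' where "Z' t = (2 * (R t / \<omega>) * (U t * (V t / \<omega>)) - M / \<omega> * E t) * exp (- (M / \<omega>) * (t - a))" for t
  have M0: "M \<ge> 0" using M[OF x] by linarith
  have \<omega>0: "\<omega> \<noteq> 0" using \<omega> by linarith
  have Z_deriv: "(Z has_real_derivative Z' t) (at t within {a..b})" if t: "t \<in> {a..b}" for t
    unfolding Z_def E_def Z'_def
    by (rule derivative_eq_intros U V t \<omega>0 refl)+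
      (use \<omega> in \<open>simp add: field_simps power2_eq_square\<close>)
  have Z'_le: "Z' t \<le> 0" if t: "t \<in> {a..b}" for t
  proof -
    have am: "2 * \<bar>U t * (V t / \<omega>)\<bar> \<le> E t"
    proof -
      show ?thesis
        using sum_squares_bound[of "\<bar>U t\<bar>" "\<bar>V t / \<omega>\<bar>"]
        unfolding E_def abs_mult power2_abs by (simp only: mult.assoc)
    qed
    have "R t / \<omega> * (2 * (U t * (V t / \<omega>))) \<le> \<bar>R t / \<omega>\<bar> * \<bar>2 * (U t * (V t / \<omega>))\<bar>"
      by (metis abs_ge_self abs_mult)
    also have "\<dots> \<le> (M / \<omega>) * E t"
      using M[OF t] am \<omega> M0 by (intro mult_mono) (auto simp: abs_mult divide_right_mono)
    also have "R t / \<omega> * (2 * (U t * (V t / \<omega>))) = 2 * (R t / \<omega>) * (U t * (V t / \<omega>))"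
      by (simp only: mult.assoc mult.left_commute)
    finally have "2 * (R t / \<omega>) * (U t * (V t / \<omega>)) - M / \<omega> * E t \<le> 0" by linarith
    then show ?thesis
      unfolding Z'_def by (rule mult_nonpos_nonneg) simp
  qed
  have "Z x \<le> Z a"
  proof (cases "a = x")
    case False
    then have "a < x" using x by auto
    have "\<exists>y\<in>{a<..<x}. Z x - Z a = Z' y * (x - a)"
    proof (rule mvt_simple[OF \<open>a < x\<close>])
      fix t assume "a \<le> t" "t \<le> x"
      then have "(Z has_real_derivative Z' t) (at t within {a..x})"
        using x by (intro has_field_derivative_subset[OF Z_deriv]) auto
      then show "(Z has_derivative (*) (Z' t)) (at t within {a..x})"
        by (simp add: has_field_derivative_def)
    qed
    then obtain y where "y \<in> {a<..<x}" "Z x - Z a = Z' y * (x - a)" by blast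
    moreover have "Z' y * (x - a) \<le> 0"
      using Z'_le[of y] x \<open>y \<in> _\<close> by (intro mult_nonpos_nonneg) auto
    ultimately show ?thesis by simp
  qed simp
  then have "E x * exp (- (M / \<omega>) * (x - a)) \<le> E a" by (simp add: Z_def)
  then have "E x * exp (- (M / \<omega>) * (x - a)) * exp (M / \<omega> * (x - a)) \<le> E a * exp (M / \<omega> * (x - a))"
    by (rule mult_right_mono) simp
  also have "E x * exp (- (M / \<omega>) * (x - a)) * exp (M / \<omega> * (x - a)) = E x"
    by (simp add: mult.assoc flip: exp_add)
  also have "E a * exp (M / \<omega> * (x - a)) \<le> E a * exp (M * (b - a))"
  proof -
    have "M / \<omega> \<le> M" using M0 \<omega> by (simp add: divide_le_eq mult_left_mono[of 1 \<omega> M, simplified])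
    then have "M / \<omega> * (x - a) \<le> M * (b - a)" using x M0 \<omega> by (intro mult_mono) auto
    then show ?thesis by (intro mult_left_mono) (auto simp: E_def)
  qed
  finally show ?thesis by (simp add: E_def)
qed

text \<open>
  Variation of constants: writing U = X cos (\<omega> \<tau>) + Y sin (\<omega> \<tau>) and
  V / \<omega> = Y cos (\<omega> \<tau>) - X sin (\<omega> \<tau>), the derivatives of X and Y are - (R / \<omega>) U sin (\<omega> \<tau>) and
  (R / \<omega>) U cos (\<omega> \<tau>).  Hence X and Y stay within O(1 / \<omega>) of their values U a and V a / \<omega>.
\<close>

lemma slowly_varying_coefficients:
  fixes \<sigma> R \<tau> U V :: "real \<Rightarrow> real"
  assumes U: "\<And>x. x \<in> {a..b} \<Longrightarrow> (U has_real_derivative \<sigma> x * V x) (at x within {a..b})"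
    and V: "\<And>x. x \<in> {a..b} \<Longrightarrow>
      (V has_real_derivative (R x - \<omega>\<^sup>2 * \<sigma> x) * U x) (at x within {a..b})"
    and \<tau>: "\<And>x. x \<in> {a..b} \<Longrightarrow> (\<tau> has_real_derivative \<sigma> x) (at x within {a..b})" "\<tau> a = 0"
    and M: "\<And>x. x \<in> {a..b} \<Longrightarrow> \<bar>R x\<bar> \<le> M" and \<omega>: "\<omega> \<ge> 1" and x: "x \<in> {a..b}"
  defines "B \<equiv> M * (b - a) * exp (M * (b - a)) * sqrt ((U a)\<^sup>2 + (V a / \<omega>)\<^sup>2) / \<omega>"
  shows "\<bar>U x * cos (\<omega> * \<tau> x) - V x / \<omega> * sin (\<omega> * \<tau> x) - U a\<bar> \<le> B"
    and "\<bar>U x * sin (\<omega> * \<tau> x) + V x / \<omega> * cos (\<omega> * \<tau> x) - V a / \<omega>\<bar> \<le> B"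
proof -
  define X where "X t = U t * cos (\<omega> * \<tau> t) - V t / \<omega> * sin (\<omega> * \<tau> t)" for t
  define Y where "Y t = U t * sin (\<omega> * \<tau> t) + V t / \<omega> * cos (\<omega> * \<tau> t)" for t
  define K where "K = M / \<omega> * (sqrt ((U a)\<^sup>2 + (V a / \<omega>)\<^sup>2) * exp (M * (b - a)))"
  have M0: "M \<ge> 0" using M[OF x] by linarith
  have \<omega>0: "\<omega> \<noteq> 0" using \<omega> by linarith
  have X': "(X has_real_derivative - (R t / \<omega> * (U t * sin (\<omega> * \<tau> t)))) (at t within {a..b})"
    if t: "t \<in> {a..b}" for t
    unfolding X_def
    by (rule derivative_eq_intros U V \<tau> t \<omega>0 refl)+
      (use \<omega> in \<open>simp add: field_simps power2_eq_square\<close>)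
  have Y': "(Y has_real_derivative R t / \<omega> * (U t * cos (\<omega> * \<tau> t))) (at t within {a..b})"
    if t: "t \<in> {a..b}" for t
    unfolding Y_def
    by (rule derivative_eq_intros U V \<tau> t \<omega>0 refl)+
      (use \<omega> in \<open>simp add: field_simps power2_eq_square\<close>)
  have U_le: "\<bar>U t\<bar> \<le> sqrt ((U a)\<^sup>2 + (V a / \<omega>)\<^sup>2) * exp (M * (b - a))" if t: "t \<in> {a..b}" for t
  proof -
    have "(U t)\<^sup>2 \<le> (U t)\<^sup>2 + (V t / \<omega>)\<^sup>2" by simp
    also have "\<dots> \<le> ((U a)\<^sup>2 + (V a / \<omega>)\<^sup>2) * exp (M * (b - a))"
      by (rule exponential_energy_bound[OF U V M \<omega> t])
    also have "\<dots> \<le> ((U a)\<^sup>2 + (V a / \<omega>)\<^sup>2) * (exp (M * (b - a)))\<^sup>2"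
    proof (intro mult_left_mono)
      have "1 \<le> exp (M * (b - a))" using M0 x by simp
      then show "exp (M * (b - a)) \<le> (exp (M * (b - a)))\<^sup>2" 
        by (simp add: power2_eq_square)
    qed simp
    finally have "sqrt ((U t)\<^sup>2) \<le> sqrt (((U a)\<^sup>2 + (V a / \<omega>)\<^sup>2) * (exp (M * (b - a)))\<^sup>2)"
      by (rule real_sqrt_le_mono)
    then show ?thesis by (simp add: real_sqrt_mult)
  qed
  have coeff: "\<bar>R t / \<omega> * (U t * z)\<bar> \<le> K" if t: "t \<in> {a..b}" and z: "\<bar>z\<bar> \<le> 1" for t z
  proof -
    have "\<bar>U t\<bar> * \<bar>z\<bar> \<le> (sqrt ((U a)\<^sup>2 + (V a / \<omega>)\<^sup>2) * exp (M * (b - a))) * 1"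
      by (intro mult_mono U_le t z) auto
    moreover have "\<bar>R t / \<omega>\<bar> \<le> M / \<omega>" using M[OF t] \<omega> by (simp add: divide_right_mono)
    ultimately have "\<bar>R t / \<omega>\<bar> * (\<bar>U t\<bar> * \<bar>z\<bar>) \<le> K"
      unfolding K_def by (intro mult_mono[OF _ order_trans]) (use M0 \<omega> in auto)
    then show ?thesis by (simp only: abs_mult)
  qed
  have a: "a \<in> {a..b}" using x by auto
  have K0: "K \<ge> 0" unfolding K_def using M0 \<omega> by simp
  have "K * \<bar>x - a\<bar> \<le> K * (b - a)" using K0 x by (intro mult_left_mono) auto
  also have "\<dots> = B" by (simp add: K_def B_def)
  finally have KB: "K * norm (x - a) \<le> B" by simp
  have "norm (X x - X a) \<le> K * norm (x - a)"
  proof (rule field_differentiable_bound[where S = "{a..b}"])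
    fix t assume t: "t \<in> {a..b}"
    show "norm (- (R t / \<omega> * (U t * sin (\<omega> * \<tau> t)))) \<le> K"
      unfolding real_norm_def abs_minus_cancel by (rule coeff[OF t abs_sin_le_one])
  qed (use X' x a in auto)
  with KB show "\<bar>U x * cos (\<omega> * \<tau> x) - V x / \<omega> * sin (\<omega> * \<tau> x) - U a\<bar> \<le> B"
    by (simp add: X_def \<tau>(2))
  have "norm (Y x - Y a) \<le> K * norm (x - a)"
  proof (rule field_differentiable_bound[where S = "{a..b}"])
    fix t assume t: "t \<in> {a..b}"
    show "norm (R t / \<omega> * (U t * cos (\<omega> * \<tau> t))) \<le> K"
      unfolding real_norm_def by (rule coeff[OF t abs_cos_le_one])
  qed (use Y' x a in auto)
  with KB show "\<bar>U x * sin (\<omega> * \<tau> x) + V x / \<omega> * cos (\<omega> * \<tau> x) - V a / \<omega>\<bar> \<le> B"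
    by (simp add: Y_def \<tau>(2))
qed

context liouville_form
begin

lemma R_bound: "\<exists>M. \<forall>x\<in>{a..b}. \<bar>R x\<bar> \<le> M"
proof -
  have "bounded (R ` {a..b})"
    by (intro compact_imp_bounded compact_continuous_image R_cont) simp
  then show ?thesis by (auto simp: bounded_iff)
qed

text \<open>
  The condition at a makes the pair (X, Y) start at r (cos \<theta>0, sin \<theta>0) up to O(r / \<omega>), and by
  \<open>slowly_varying_coefficients\<close> it stays there.  The factor r cannot vanish, for then the energy would
  vanish identically.
\<close>

lemma eigenfunction_asymptotics:
  "\<exists>C\<ge>0. \<forall>n. ev n \<ge> 1 \<longrightarrow> (\<exists>r. r \<noteq> 0 \<and> (\<forall>x\<in>{a..b}.
      \<bar>u n x / r - cos (sqrt (ev n) * \<tau> x - \<theta>0)\<bar> \<le> C / sqrt (ev n) \<and>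
      \<bar>v n x / (r * sqrt (ev n)) + sin (sqrt (ev n) * \<tau> x - \<theta>0)\<bar> \<le> C / sqrt (ev n)))"
proof -
  obtain M where M: "\<And>x. x \<in> {a..b} \<Longrightarrow> \<bar>R x\<bar> \<le> M" using R_bound by blast
  have M0: "M \<ge> 0" using M[OF ends(1)] by linarith
  define B where "B = M * (b - a) * exp (M * (b - a))"
  have B0: "B \<ge> 0" using M0 ab by (simp add: B_def)
  define C where "C = 2 * (B * (1 + \<bar>h\<bar>)) + \<bar>h\<bar>"
  have C0: "C \<ge> 0" using B0 by (simp add: C_def)
  have "\<exists>r. r \<noteq> 0 \<and> (\<forall>x\<in>{a..b}.
      \<bar>u n x / r - cos (sqrt (ev n) * \<tau> x - \<theta>0)\<bar> \<le> C / sqrt (ev n) \<and>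
      \<bar>v n x / (r * sqrt (ev n)) + sin (sqrt (ev n) * \<tau> x - \<theta>0)\<bar> \<le> C / sqrt (ev n))"
    if ev1: "ev n \<ge> 1" for n
  proof -
    define \<omega> where "\<omega> = sqrt (ev n)"
    have \<omega>: "\<omega> \<ge> 1" using ev1 by (simp add: \<omega>_def)
    have \<omega>2: "\<omega>\<^sup>2 = ev n" using ev1 by (simp add: \<omega>_def)
    have v': "(v n has_real_derivative (R x - \<omega>\<^sup>2 * \<sigma> x) * u n x) (at x within {a..b})"
      if "x \<in> {a..b}" for x using v_deriv[OF that] by (simp add: \<omega>2)
    \<comment> \<open>the dominant initial value: the condition at the left end determines the other one\<close>
    define r where "r = (if \<theta>0 = 0 then u n a else v n a / \<omega>)"
    define X where "X t = u n t * cos (\<omega> * \<tau> t) - v n t / \<omega> * sin (\<omega> * \<tau> t)" for t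
    define Y where "Y t = u n t * sin (\<omega> * \<tau> t) + v n t / \<omega> * cos (\<omega> * \<tau> t)" for t
    define E where "E = (u n a)\<^sup>2 + (v n a / \<omega>)\<^sup>2"
    note bc = bc_left[of n]
    have r_left: "u n a = r * cos \<theta>0" "\<bar>v n a / \<omega> - r * sin \<theta>0\<bar> \<le> \<bar>r\<bar> * \<bar>h\<bar> / \<omega>"
    proof -
      have 1: "cos \<theta>0 = 0" "sin \<theta>0 = 1" if "\<theta>0 = pi / 2" by (simp_all only: that cos_pi_half sin_pi_half)
      show "u n a = r * cos \<theta>0" "\<bar>v n a / \<omega> - r * sin \<theta>0\<bar> \<le> \<bar>r\<bar> * \<bar>h\<bar> / \<omega>"
        using bc \<omega> 1 pi_gt_zero by (auto simp: r_def abs_mult mult.commute)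
    qed
    have r_E: "sqrt E \<le> \<bar>r\<bar> * (1 + \<bar>h\<bar>)"
    proof -
      have "sqrt E \<le> \<bar>u n a\<bar> + \<bar>v n a / \<omega>\<bar>" unfolding E_def by (rule sqrt_sum_squares_le_sum_abs)
      also have "\<dots> \<le> \<bar>r\<bar> * (1 + \<bar>h\<bar>)"
      proof (cases "\<theta>0 = 0")
        case True
        then have 1: "v n a = h * u n a" using bc by auto
        have "\<bar>h * u n a / \<omega>\<bar> \<le> \<bar>h * u n a\<bar>" using \<omega> by (simp add: divide_le_eq mult_left_mono[of 1 \<omega>, simplified])
        then show ?thesis using True 1 by (simp add: r_def abs_mult algebra_simps)
      next
        case False
        then show ?thesis using bc by (simp add: r_def)
      qed
      finally show ?thesis .
    qed
    have "r \<noteq> 0"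
    proof
      assume "r = 0"
      then have "sqrt E \<le> 0" using r_E by simp
      then have "E = 0" by (simp add: E_def sum_power2_le_zero_iff)
      obtain x where x: "x \<in> {a..b}" "u n x \<noteq> 0" using nontrivial by blast
      have "(u n x)\<^sup>2 \<le> (u n x)\<^sup>2 + (v n x / \<omega>)\<^sup>2" by simp
      also have "\<dots> \<le> E * exp (M * (b - a))"
        unfolding E_def by (rule exponential_energy_bound[OF u_deriv v' M \<omega> x(1)])
      finally show False using \<open>E = 0\<close> x(2) by simp
    qed
    have BE: "B * sqrt E / \<omega> \<le> \<bar>r\<bar> * (B * (1 + \<bar>h\<bar>)) / \<omega>"
      using mult_left_mono[OF r_E B0] \<omega> by (simp add: divide_right_mono mult_ac)
    have XY: "\<bar>X x - r * cos \<theta>0\<bar> \<le> \<bar>r\<bar> * (B * (1 + \<bar>h\<bar>)) / \<omega>"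
      "\<bar>Y x - r * sin \<theta>0\<bar> \<le> \<bar>r\<bar> * (B * (1 + \<bar>h\<bar>) + \<bar>h\<bar>) / \<omega>" if x: "x \<in> {a..b}" for x
    proof -
      note s = slowly_varying_coefficients[OF u_deriv v' \<tau>_deriv \<tau>_left M \<omega> x, folded X_def Y_def E_def B_def]
      show "\<bar>X x - r * cos \<theta>0\<bar> \<le> \<bar>r\<bar> * (B * (1 + \<bar>h\<bar>)) / \<omega>"
        using s(1) BE r_left(1) by linarith
      have "\<bar>Y x - r * sin \<theta>0\<bar> \<le> \<bar>r\<bar> * (B * (1 + \<bar>h\<bar>)) / \<omega> + \<bar>r\<bar> * \<bar>h\<bar> / \<omega>"
        using s(2) BE r_left(2) by linarith
      then show "\<bar>Y x - r * sin \<theta>0\<bar> \<le> \<bar>r\<bar> * (B * (1 + \<bar>h\<bar>) + \<bar>h\<bar>) / \<omega>"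
        by (simp add: distrib_left add_divide_distrib)
    qed
    have rot: "\<bar>p * y + q * z\<bar> \<le> \<bar>r\<bar> * C / \<omega>"
      if "\<bar>p\<bar> \<le> \<bar>r\<bar> * (B * (1 + \<bar>h\<bar>)) / \<omega>" "\<bar>q\<bar> \<le> \<bar>r\<bar> * (B * (1 + \<bar>h\<bar>) + \<bar>h\<bar>) / \<omega>" "\<bar>y\<bar> \<le> 1" "\<bar>z\<bar> \<le> 1"
      for p q y z
    proof -
      have "\<bar>p * y\<bar> \<le> \<bar>p\<bar>" "\<bar>q * z\<bar> \<le> \<bar>q\<bar>" 
        using that by (simp_all add: abs_mult mult_left_le)
      then have "\<bar>p * y + q * z\<bar> \<le> \<bar>r\<bar> * (B * (1 + \<bar>h\<bar>)) / \<omega> + \<bar>r\<bar> * (B * (1 + \<bar>h\<bar>) + \<bar>h\<bar>) / \<omega>"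
        using that by linarith
      also have "\<dots> = \<bar>r\<bar> * C / \<omega>" by (simp add: C_def add_divide_distrib[symmetric] algebra_simps)
      finally show ?thesis .
    qed
    have "\<bar>u n x / r - cos (\<omega> * \<tau> x - \<theta>0)\<bar> \<le> C / \<omega> \<and>
      \<bar>v n x / (r * \<omega>) + sin (\<omega> * \<tau> x - \<theta>0)\<bar> \<le> C / \<omega>" if x: "x \<in> {a..b}" for x
    proof -
      define C1 S1 where "C1 = cos (\<omega> * \<tau> x)" and "S1 = sin (\<omega> * \<tau> x)"
      have sc: "S1 * S1 + C1 * C1 = 1"
        using sin_cos_squared_add[of "\<omega> * \<tau> x"] by (simp add: C1_def S1_def power2_eq_square)
      have sc': "S1 * (S1 * y) + C1 * (C1 * y) = y" for y
        using sc by (metis distrib_right mult.assoc mult_1)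
      have ux: "u n x = X x * C1 + Y x * S1"
        using sc'[of "u n x"] by (simp add: X_def Y_def C1_def[symmetric] S1_def[symmetric] algebra_simps)
      have vx: "v n x / \<omega> = Y x * C1 - X x * S1"
        using sc'[of "v n x / \<omega>"] by (simp add: X_def Y_def C1_def[symmetric] S1_def[symmetric] algebra_simps)
      have ab1: "\<bar>C1\<bar> \<le> 1" "\<bar>S1\<bar> \<le> 1" "\<bar>- S1\<bar> \<le> 1" by (simp_all add: C1_def S1_def)
      have "u n x - r * cos (\<omega> * \<tau> x - \<theta>0) = (X x - r * cos \<theta>0) * C1 + (Y x - r * sin \<theta>0) * S1"
        by (simp add: ux cos_diff C1_def S1_def algebra_simps)
      then have 1: "\<bar>u n x - r * cos (\<omega> * \<tau> x - \<theta>0)\<bar> \<le> \<bar>r\<bar> * C / \<omega>"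
        using rot[OF XY(1)[OF x] XY(2)[OF x] ab1(1,2)] by simp
      have "v n x / \<omega> + r * sin (\<omega> * \<tau> x - \<theta>0) = (X x - r * cos \<theta>0) * (- S1) + (Y x - r * sin \<theta>0) * C1"
        by (simp add: vx sin_diff C1_def S1_def algebra_simps)
      then have 2: "\<bar>v n x / \<omega> + r * sin (\<omega> * \<tau> x - \<theta>0)\<bar> \<le> \<bar>r\<bar> * C / \<omega>"
        using rot[OF XY(1)[OF x] XY(2)[OF x] ab1(3,1)] by simp
      have scale: "\<bar>y / r + z\<bar> \<le> C / \<omega>" if "\<bar>y + r * z\<bar> \<le> \<bar>r\<bar> * C / \<omega>" for y z
      proof -
        have "\<bar>r\<bar> * \<bar>y / r + z\<bar> = \<bar>y + r * z\<bar>"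
          using \<open>r \<noteq> 0\<close> by (simp add: abs_mult[symmetric] distrib_left)
        also have "\<dots> \<le> \<bar>r\<bar> * (C / \<omega>)" using that by simp
        finally show ?thesis by (rule mult_left_le_imp_le) (simp add: \<open>r \<noteq> 0\<close>)
      qed
      show ?thesis
        using scale[of "u n x" "- cos (\<omega> * \<tau> x - \<theta>0)"] scale[of "v n x / \<omega>" "sin (\<omega> * \<tau> x - \<theta>0)"] 1 2
        by (simp add: mult.commute)
    qed
    then show ?thesis using \<open>r \<noteq> 0\<close> unfolding \<omega>_def by blast
  qed
  with C0 show ?thesis by blast
qed

end

section \<open>Approximate eigenfunctions\<close>

lemma trig_at_half_pi: "x = pi / 2 \<Longrightarrow> sin x = 1 \<and> cos x = 0 \<and> sin (2 * x) = 0" for x :: real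
  by (simp only: sin_pi_half cos_pi_half sin_double) simp

context liouville_form
begin

definition \<kappa> :: "int \<Rightarrow> real" where
  "\<kappa> k = (of_int k * pi + \<theta>0 + \<theta>1) / c"

definition mode :: "int \<Rightarrow> real \<Rightarrow> real" where
  "mode k x = cos (\<kappa> k * \<tau> x - \<theta>0)"

lemma phases: "\<theta>0 = 0 \<or> \<theta>0 = pi / 2" "\<theta>1 = 0 \<or> \<theta>1 = pi / 2"
  using bc_left bc_right by blast+

lemma phases_double: "sin (2 * \<theta>0) = 0" "sin (2 * \<theta>1) = 0"
  using phases trig_at_half_pi[of \<theta>0] trig_at_half_pi[of \<theta>1] by auto

lemma \<kappa>_right: "\<kappa> k * c = of_int k * pi + \<theta>0 + \<theta>1"
  using c_pos by (simp add: \<kappa>_def)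

lemma mode_cont: "continuous_on {a..b} (mode k)"
  unfolding mode_def by (intro continuous_intros \<tau>_cont)

lemma mode_le_1: "\<bar>mode k x\<bar> \<le> 1"
  by (simp add: mode_def)

text \<open>
  Exact equality holds because 2 (\<kappa> k \<tau> - \<theta>0) is a multiple of \<pi> at both ends.
\<close>

lemma ip_mode:
  assumes "\<kappa> k \<noteq> 0"
  shows "ip (mode k) (mode k) = c / 2"
proof -
  define F where "F x = \<tau> x / 2 + sin (2 * (\<kappa> k * \<tau> x - \<theta>0)) / (4 * \<kappa> k)" for x
  have \<kappa>4: "4 * \<kappa> k \<noteq> 0" and two: "(2::real) \<noteq> 0" using assms by simp_all
  have F': "(F has_real_derivative mode k x * mode k x * \<sigma> x) (at x within {a..b})"
    if x: "x \<in> {a..b}" for x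
  proof -
    have m: "mode k x * mode k x * \<sigma> x = \<sigma> x * (1 + cos (2 * (\<kappa> k * \<tau> x - \<theta>0))) / 2"
      unfolding mode_def cos_double_cos power2_eq_square by simp
    show ?thesis unfolding m F_def
      by (rule derivative_eq_intros \<tau>_deriv x \<kappa>4 two refl)+
        (use assms in \<open>simp add: field_simps\<close>)
  qed
  have "((\<lambda>x. mode k x * mode k x * \<sigma> x) has_integral (F b - F a)) {a..b}"
    using ab F' by (intro fundamental_theorem_of_calculus)
      (auto simp: has_real_derivative_iff_has_vector_derivative)
  then have "ip (mode k) (mode k) = F b - F a"
    by (simp add: ip_def integral_unique)
  also have "F a = 0" using phases_double(1) by (simp add: F_def \<tau>_left)
  also have "F b = c / 2"
  proof -
    have "2 * (\<kappa> k * c - \<theta>0) = 2 * \<theta>1 + 2 * pi * of_int k"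
      unfolding \<kappa>_right by (simp add: algebra_simps)
    then have "sin (2 * (\<kappa> k * c - \<theta>0)) = 0"
      using phases_double(2) by (simp add: sin_add)
    then show ?thesis by (simp add: F_def c_def[symmetric])
  qed
  finally show ?thesis by simp
qed

text \<open>
  Green's formula: the Wronskian of f and u n vanishes at both ends when f satisfies the boundary
  conditions.
\<close>

lemma green_identity:
  assumes f: "\<And>x. x \<in> {a..b} \<Longrightarrow> (f has_real_derivative \<sigma> x * fd x) (at x within {a..b})"
    and fd: "\<And>x. x \<in> {a..b} \<Longrightarrow>
      (fd has_real_derivative (R x - \<mu> * \<sigma> x) * f x + \<sigma> x * g x) (at x within {a..b})"
    and g: "continuous_on {a..b} g"
    and left: "f a * v n a = fd a * u n a" and right: "f b * v n b = fd b * u n b"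
  shows "(\<mu> - ev n) * ip f (u n) = ip g (u n)"
proof -
  define W where "W x = f x * v n x - fd x * u n x" for x
  have f_cont: "continuous_on {a..b} f" by (rule DERIV_continuous_on[OF f])
  have "(W has_real_derivative (\<mu> - ev n) * (f x * u n x * \<sigma> x) - g x * u n x * \<sigma> x) (at x within {a..b})"
    if x: "x \<in> {a..b}" for x
    unfolding W_def
    by (rule derivative_eq_intros f fd u_deriv v_deriv x refl)+ (simp add: algebra_simps)
  then have "((\<lambda>x. (\<mu> - ev n) * (f x * u n x * \<sigma> x) - g x * u n x * \<sigma> x) has_integral (W b - W a)) {a..b}"
    using ab by (intro fundamental_theorem_of_calculus)
      (auto simp: has_real_derivative_iff_has_vector_derivative)
  moreover have "((\<lambda>x. (\<mu> - ev n) * (f x * u n x * \<sigma> x) - g x * u n x * \<sigma> x) has_integral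
      ((\<mu> - ev n) * ip f (u n) - ip g (u n))) {a..b}"
    unfolding ip_def
    by (intro has_integral_diff has_integral_mult_right integrable_integral ip_integrable f_cont g u_cont)
  ultimately have "(\<mu> - ev n) * ip f (u n) - ip g (u n) = W b - W a"
    using has_integral_unique by blast
  also have "\<dots> = 0" using left right by (simp add: W_def)
  finally show ?thesis by simp
qed

text \<open>
  The approximate eigenfunction is f = cos A + \<psi> sin A / \<kappa> with A = \<kappa> \<tau> - \<theta>0 and \<psi> affine in \<tau>.
  Taking \<psi> = h at a and \<psi> = H at b makes f satisfy the boundary conditions, while, for derivatives with
  respect to \<tau>, f'' + \<kappa>^2 f = 2 \<psi>' cos A stays bounded as \<kappa> grows.  If no eigenvalue were within G of
  \<kappa>^2, then by \<open>spectral_gap\<close> the bounded residual would have at least G times the norm of f, which is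
  bounded below.
\<close>

lemma eigenvalue_near_\<kappa>_square:
  obtains G k0 where "G > 0" and "k0 \<ge> 1"
    and "\<And>k. \<kappa> k \<ge> k0 \<Longrightarrow> \<exists>n. \<bar>ev n - (\<kappa> k)\<^sup>2\<bar> < G"
proof -
  have "continuous_on {a..b} (\<lambda>x. R x / \<sigma> x)"
    using \<sigma>_pos by (intro continuous_intros R_cont \<sigma>_cont) force
  then have "bounded ((\<lambda>x. R x / \<sigma> x) ` {a..b})"
    by (intro compact_imp_bounded compact_continuous_image) simp_all
  then obtain Q where Q: "\<And>x. x \<in> {a..b} \<Longrightarrow> \<bar>R x / \<sigma> x\<bar> \<le> Q"
    unfolding bounded_iff real_norm_def by blast
  have Q0: "Q \<ge> 0" using Q[OF ends(1)] by linarith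
  define d where "d = (H - h) / c"
  define \<psi> where "\<psi> x = h + d * \<tau> x" for x
  define \<Psi> where "\<Psi> = \<bar>h\<bar> + \<bar>H\<bar>"
  have \<Psi>0: "\<Psi> \<ge> 0" by (simp add: \<Psi>_def)
  have \<psi>_le: "\<bar>\<psi> x\<bar> \<le> \<Psi>" if x: "x \<in> {a..b}" for x
  proof -
    define s where "s = \<tau> x / c"
    have s: "0 \<le> s" "s \<le> 1" using \<tau>_range[OF x] c_pos by (simp_all add: s_def)
    have "\<psi> x = h * (1 - s) + H * s"
      by (simp add: \<psi>_def d_def s_def algebra_simps add_divide_distrib diff_divide_distrib)
    also have "\<bar>\<dots>\<bar> \<le> \<bar>h\<bar> * \<bar>1 - s\<bar> + \<bar>H\<bar> * \<bar>s\<bar>" by (metis abs_mult abs_triangle_ineq)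
    also have "\<dots> \<le> \<bar>h\<bar> * 1 + \<bar>H\<bar> * 1" using s by (intro add_mono mult_left_mono) auto
    finally show ?thesis by (simp add: \<Psi>_def)
  qed
  define B where "B = 2 * \<bar>d\<bar> + Q * (1 + \<Psi>)"
  have B0: "B \<ge> 0" using Q0 \<Psi>0 by (simp add: B_def)
  \<comment> \<open>the bounds ip g g \<le> B^2 c and ip f f \<ge> c / 8 below exclude a gap G as soon as G^2 > 8 B^2\<close>
  define G where "G = 3 * B + 1"
  have G0: "G > 0" using B0 by (simp add: G_def)
  \<comment> \<open>the bound on \<kappa> keeps the correction \<psi> sin A / \<kappa> below 1/3, so that it cannot cancel the cosine\<close>
  have near: "\<exists>n. \<bar>ev n - (\<kappa> k)\<^sup>2\<bar> < G" if k: "\<kappa> k \<ge> 1 + 3 * \<Psi>" for k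
  proof (rule ccontr)
    assume "\<not> ?thesis"
    then have gap: "\<bar>ev n - (\<kappa> k)\<^sup>2\<bar> \<ge> G" for n by (simp add: not_less)
    have \<kappa>1: "\<kappa> k \<ge> 1" using k \<Psi>0 by linarith
    then have \<kappa>0: "\<kappa> k \<noteq> 0" by linarith
    define A where "A x = \<kappa> k * \<tau> x - \<theta>0" for x
    define f where "f x = cos (A x) + \<psi> x * sin (A x) / \<kappa> k" for x
    define fd where "fd x = - \<kappa> k * sin (A x) + \<psi> x * cos (A x) + d * sin (A x) / \<kappa> k" for x
    define g where "g x = 2 * d * cos (A x) - R x / \<sigma> x * f x" for x
    have A': "(A has_real_derivative \<kappa> k * \<sigma> x) (at x within {a..b})" if x: "x \<in> {a..b}" for x
      unfolding A_def by (rule derivative_eq_intros \<tau>_deriv x refl)+ simp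
    have \<psi>': "(\<psi> has_real_derivative d * \<sigma> x) (at x within {a..b})" if x: "x \<in> {a..b}" for x
      unfolding \<psi>_def by (rule derivative_eq_intros \<tau>_deriv x refl)+ simp
    have f': "(f has_real_derivative \<sigma> x * fd x) (at x within {a..b})" if x: "x \<in> {a..b}" for x
      unfolding f_def fd_def
      by (rule derivative_eq_intros A' \<psi>' x \<kappa>0 refl)+ (use \<kappa>0 in \<open>simp add: field_simps\<close>)
    have fd': "(fd has_real_derivative (R x - (\<kappa> k)\<^sup>2 * \<sigma> x) * f x + \<sigma> x * g x) (at x within {a..b})"
      if x: "x \<in> {a..b}" for x
    proof -
      have e: "(R x - (\<kappa> k)\<^sup>2 * \<sigma> x) * f x + \<sigma> x * g x = \<sigma> x * (2 * d * cos (A x) - (\<kappa> k)\<^sup>2 * f x)"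
        using \<sigma>_pos[OF x] by (simp add: g_def field_simps)
      show ?thesis unfolding e unfolding f_def fd_def
        by (rule derivative_eq_intros A' \<psi>' x \<kappa>0 refl)+
          (use \<kappa>0 in \<open>simp add: field_simps power2_eq_square\<close>)
    qed
    have f_cont: "continuous_on {a..b} f" by (rule DERIV_continuous_on[OF f'])
    have g_cont: "continuous_on {a..b} g"
      unfolding g_def A_def using \<sigma>_pos
      by (intro continuous_intros \<tau>_cont f_cont R_cont \<sigma>_cont) force
    have ends_A: "A a = - \<theta>0" "A b = of_int k * pi + \<theta>1"
      by (simp_all add: A_def \<tau>_left c_def[symmetric] \<kappa>_right)
    have ends_\<psi>: "\<psi> a = h" "\<psi> b = H"
      using c_pos by (simp_all add: \<psi>_def \<tau>_left c_def[symmetric] d_def)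
    have eq: "((\<kappa> k)\<^sup>2 - ev n) * ip f (u n) = ip g (u n)" for n
    proof (rule green_identity[OF f' fd' g_cont])
      show "f a * v n a = fd a * u n a"
        using bc_left[of n] trig_at_half_pi[of \<theta>0] by (auto simp: f_def fd_def ends_A ends_\<psi>)
      have "sin (of_int k * pi) = 0" by (simp add: sin_zero_iff_int2)
      then show "f b * v n b = fd b * u n b"
        using bc_right[of n] trig_at_half_pi[of \<theta>1] by (auto simp: f_def fd_def ends_A ends_\<psi> cos_add sin_add)
    qed
    have "ip g g \<le> B\<^sup>2 * c"
    proof -
      have "\<bar>g x\<bar> \<le> B" if x: "x \<in> {a..b}" for x
      proof -
        have "\<bar>\<psi> x * sin (A x) / \<kappa> k\<bar> \<le> \<Psi>"
        proof -
          have "\<bar>\<psi> x\<bar> * \<bar>sin (A x)\<bar> \<le> \<Psi> * 1"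
            using \<psi>_le[OF x] \<Psi>0 by (intro mult_mono) auto
          also have "\<dots> \<le> \<Psi> * \<kappa> k" using \<kappa>1 \<Psi>0 by (intro mult_left_mono) auto
          finally show ?thesis using \<kappa>1 by (simp add: abs_mult pos_divide_le_eq)
        qed
        then have "\<bar>f x\<bar> \<le> 1 + \<Psi>" unfolding f_def using abs_cos_le_one[of "A x"] by linarith
        then have "\<bar>R x / \<sigma> x\<bar> * \<bar>f x\<bar> \<le> Q * (1 + \<Psi>)"
          using Q[OF x] Q0 by (intro mult_mono) auto
        then have "\<bar>R x / \<sigma> x * f x\<bar> \<le> Q * (1 + \<Psi>)" by (simp only: abs_mult)
        moreover have "\<bar>2 * d * cos (A x)\<bar> \<le> 2 * \<bar>d\<bar>"
          by (simp add: abs_mult mult_left_le)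
        ultimately show ?thesis unfolding g_def B_def by linarith
      qed
      then have "\<bar>g x * g x\<bar> \<le> B\<^sup>2" if "x \<in> {a..b}" for x
        using that B0 unfolding abs_mult power2_eq_square by (intro mult_mono) auto
      then have "\<bar>integral {a..b} (\<lambda>x. g x * g x * \<sigma> x)\<bar> \<le> B\<^sup>2 * c"
        by (intro weighted_integral_bound continuous_intros g_cont)
      then show ?thesis by (simp add: ip_def)
    qed
    moreover have "c / 8 \<le> ip f f"
    proof -
      have low: "- (1 / 8) \<le> f x * f x - 1 / 2 * (mode k x * mode k x)" if x: "x \<in> {a..b}" for x
      proof -
        define y where "y = \<psi> x * sin (A x) / \<kappa> k"
        have "\<bar>\<psi> x\<bar> * \<bar>sin (A x)\<bar> \<le> \<Psi> * 1"
          using \<psi>_le[OF x] \<Psi>0 by (intro mult_mono) auto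
        also have "\<dots> \<le> (1 / 3) * \<kappa> k" using k by simp
        finally have "\<bar>y\<bar> \<le> 1 / 3" using \<kappa>1 by (simp add: y_def abs_mult pos_divide_le_eq)
        then have "\<bar>y\<bar>\<^sup>2 \<le> (1 / 3)\<^sup>2" by (intro power_mono) auto
        then have y2: "y * y \<le> 1 / 8" by (simp add: power2_eq_square)
        have "f x = mode k x + y" by (simp add: f_def mode_def A_def y_def)
        moreover have "0 \<le> (mode k x + 2 * y)\<^sup>2" by simp
        ultimately show ?thesis using y2
          by (simp add: power2_eq_square algebra_simps)
      qed
      have "- (1 / 8) * c \<le> integral {a..b} (\<lambda>x. (f x * f x - 1 / 2 * (mode k x * mode k x)) * \<sigma> x)"
        by (rule weighted_integral_ge[OF _ low]) (intro continuous_intros f_cont mode_cont)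
      also have "\<dots> = integral {a..b} (\<lambda>x. f x * f x * \<sigma> x - 1 / 2 * (mode k x * mode k x * \<sigma> x))"
        by (simp add: algebra_simps)
      also have "\<dots> = ip f f - 1 / 2 * ip (mode k) (mode k)"
        unfolding ip_def
        by (subst integral_diff)
          (auto intro!: integrable_on_mult_right ip_integrable[where f = f] 
             ip_integrable[where f = "mode k"] f_cont mode_cont
             integrable_continuous_interval continuous_intros \<sigma>_cont)
      finally show ?thesis using ip_mode[OF \<kappa>0] by simp
    qed
    moreover have "G\<^sup>2 * ip f f \<le> ip g g"
      by (rule spectral_gap[OF f_cont g_cont eq gap G0])
    ultimately have "G\<^sup>2 * (c / 8) \<le> B\<^sup>2 * c"
      by (meson mult_left_mono order_trans zero_le_power2)
    then have "G\<^sup>2 \<le> 8 * B\<^sup>2" using c_pos by (simp add: field_simps)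
    then show False using B0 zero_le_square[of B]
      unfolding G_def power2_eq_square by (simp add: algebra_simps)
  qed
  show ?thesis
    by (rule that[of G "1 + 3 * \<Psi>"]) (use G0 \<Psi>0 near in auto)
qed

lemma \<kappa>_mono: "i \<le> j \<Longrightarrow> \<kappa> i \<le> \<kappa> j"
  using c_pos by (simp add: \<kappa>_def divide_right_mono)

lemma \<kappa>_at_top: "filterlim (\<lambda>j. \<kappa> (int j)) at_top sequentially"
proof -
  have "filterlim (\<lambda>j. (\<theta>0 + \<theta>1) / c + (pi / c) * real j) at_top sequentially"
    by (intro filterlim_tendsto_add_at_top[OF tendsto_const]
        filterlim_tendsto_pos_mult_at_top[OF tendsto_const _ filterlim_real_sequentially])
      (use c_pos in auto)
  moreover have "(\<theta>0 + \<theta>1) / c + (pi / c) * real j = \<kappa> (int j)" for j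
    by (simp add: \<kappa>_def add_divide_distrib mult.commute)
  ultimately show ?thesis by simp
qed

text \<open>
  The eigenvalues are increasing, and unbounded because there is one near every large (\<kappa> k)^2.
\<close>

lemma ev_at_top: "filterlim ev at_top sequentially"
proof -
  obtain G k0 where G: "G > 0" "k0 \<ge> 1" "\<And>k. \<kappa> k \<ge> k0 \<Longrightarrow> \<exists>n. \<bar>ev n - (\<kappa> k)\<^sup>2\<bar> < G"
    using eigenvalue_near_\<kappa>_square by blast
  show ?thesis
  proof (subst filterlim_at_top, intro allI)
    fix Z :: real
    have "\<forall>\<^sub>F j in sequentially. \<kappa> (int j) \<ge> max k0 (Z + G)"
      using \<kappa>_at_top unfolding filterlim_at_top by blast
    then obtain j where j: "\<kappa> (int j) \<ge> k0" "\<kappa> (int j) \<ge> Z + G"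
      by (auto simp: eventually_sequentially)
    obtain n where n: "\<bar>ev n - (\<kappa> (int j))\<^sup>2\<bar> < G" using G(3)[OF j(1)] by blast
    have "\<kappa> (int j) * 1 \<le> \<kappa> (int j) * \<kappa> (int j)" using j(1) G(2) by (intro mult_left_mono) auto
    then have "Z \<le> ev n" using n j(2) by (simp add: power2_eq_square)
    then show "\<forall>\<^sub>F m in sequentially. Z \<le> ev m"
      unfolding eventually_sequentially
      using ev_mono by (meson order_trans strict_mono_less_eq)
  qed
qed

end

section \<open>Numbering of the eigenvalues\<close>

lemma cos_lipschitz: "\<bar>cos x - cos y\<bar> \<le> \<bar>x - y\<bar>" for x y :: real
proof -
  have "norm (cos x - cos y) \<le> 1 * norm (x - y)"
    by (rule field_differentiable_bound[where S = UNIV and f' = "\<lambda>x. - sin x"])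
      (auto intro!: derivative_eq_intros)
  then show ?thesis by simp
qed

text \<open>
  The difference lies in [-\<pi> / 2, \<pi> / 2], where the sine is inverted by the continuous function
  \<open>arcsin\<close>.
\<close>

lemma nearest_multiple_of_pi:
  fixes z :: "nat \<Rightarrow> real"
  assumes "(\<lambda>n. sin (z n)) \<longlonglongrightarrow> 0"
  shows "(\<lambda>n. z n - of_int (round (z n / pi)) * pi) \<longlonglongrightarrow> 0"
proof -
  define y where "y n = z n - of_int (round (z n / pi)) * pi" for n
  have y_le: "\<bar>y n\<bar> \<le> pi / 2" for n
  proof -
    have "\<bar>of_int (round (z n / pi)) - z n / pi\<bar> * pi \<le> 1 / 2 * pi"
      by (intro mult_right_mono of_int_round_abs_le) simp
    also have "\<bar>of_int (round (z n / pi)) - z n / pi\<bar> * pi = \<bar>y n\<bar>"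
    proof -
      have "y n = - ((of_int (round (z n / pi)) - z n / pi) * pi)"
        by (simp add: y_def left_diff_distrib)
      then show ?thesis by (simp only: abs_minus_cancel abs_mult) simp
    qed
    finally show ?thesis by simp
  qed
  have sin_y: "\<bar>sin (y n)\<bar> = \<bar>sin (z n)\<bar>" for n
  proof -
    have "sin (of_int j * pi) = 0" for j :: int using sin_npi_int[of j] by (simp add: mult.commute)
    moreover from this have "\<bar>cos (of_int j * pi)\<bar> = 1" for j :: int
      by (rule sin_zero_abs_cos_one)
    ultimately show ?thesis by (simp add: y_def sin_diff abs_mult)
  qed
  have "(\<lambda>n. sin (y n)) \<longlonglongrightarrow> 0"
    by (rule tendsto_rabs_zero_cancel) (use tendsto_rabs_zero[OF assms] in \<open>simp add: sin_y\<close>)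
  moreover have "isCont arcsin (0 :: real)" by (rule isCont_arcsin) simp_all
  ultimately have "(\<lambda>n. arcsin (sin (y n))) \<longlonglongrightarrow> arcsin 0"
    by (rule isCont_tendsto_compose[rotated])
  moreover have "arcsin (sin (y n)) = y n" for n
    using y_le[of n] by (intro arcsin_sin) auto
  ultimately show ?thesis by (simp add: y_def)
qed

context liouville_form
begin

text \<open>
  For negative eigenvalues this is - sqrt (- ev n), by the convention for \<open>sqrt\<close> on negative numbers;
  hence it is strictly increasing in n without exception.
\<close>

definition \<omega> :: "nat \<Rightarrow> real" where "\<omega> n = sqrt (ev n)"

definition idx :: "nat \<Rightarrow> int" where "idx n = round ((\<omega> n * c - \<theta>0 - \<theta>1) / pi)"

lemma \<omega>_at_top: "filterlim \<omega> at_top sequentially"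
  unfolding \<omega>_def using filterlim_compose[OF sqrt_at_top ev_at_top] by simp

lemma idx_mono: "m \<le> n \<Longrightarrow> idx m \<le> idx n"
  unfolding idx_def \<omega>_def using c_pos strict_mono_less_eq[OF ev_mono]
  by (intro round_mono divide_right_mono) (auto intro!: mult_right_mono)

lemma over_\<omega>_tendsto_0: "(\<lambda>n. C / \<omega> n) \<longlonglongrightarrow> 0"
  by (rule real_tendsto_divide_at_top[OF tendsto_const \<omega>_at_top])

text \<open>
  Inserting \<open>eigenfunction_asymptotics\<close> into the boundary condition at b shows that
  sin (\<omega> n * c - \<theta>0 - \<theta>1) is O(1 / \<omega> n).  So \<omega> n approaches \<kappa> k for the nearest integer k, and may be
  replaced by it in the cosine.
\<close>

lemma mode_approximation:
  "\<exists>r. (\<forall>\<^sub>F n in sequentially. r n \<noteq> 0) \<and> (\<lambda>n. \<omega> n - \<kappa> (idx n)) \<longlonglongrightarrow> 0 \<and>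
    (\<forall>\<epsilon>>0. \<forall>\<^sub>F n in sequentially. \<forall>x\<in>{a..b}. \<bar>u n x / r n - mode (idx n) x\<bar> \<le> \<epsilon>)"
proof -
  obtain C where C0: "C \<ge> 0" and C: "\<And>n. ev n \<ge> 1 \<Longrightarrow> \<exists>r. r \<noteq> 0 \<and> (\<forall>x\<in>{a..b}.
      \<bar>u n x / r - cos (\<omega> n * \<tau> x - \<theta>0)\<bar> \<le> C / \<omega> n \<and>
      \<bar>v n x / (r * \<omega> n) + sin (\<omega> n * \<tau> x - \<theta>0)\<bar> \<le> C / \<omega> n)"
    using eigenfunction_asymptotics unfolding \<omega>_def by blast
  then obtain r where r: "\<And>n. ev n \<ge> 1 \<Longrightarrow> r n \<noteq> 0"
    and ru: "\<And>n x. ev n \<ge> 1 \<Longrightarrow> x \<in> {a..b} \<Longrightarrow> \<bar>u n x / r n - cos (\<omega> n * \<tau> x - \<theta>0)\<bar> \<le> C / \<omega> n"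
    and rv: "\<And>n x. ev n \<ge> 1 \<Longrightarrow> x \<in> {a..b} \<Longrightarrow>
      \<bar>v n x / (r n * \<omega> n) + sin (\<omega> n * \<tau> x - \<theta>0)\<bar> \<le> C / \<omega> n"
    by metis
  have ev1: "\<forall>\<^sub>F n in sequentially. ev n \<ge> 1"
    using ev_at_top by (simp add: filterlim_at_top)
  define z where "z n = \<omega> n * c - \<theta>0 - \<theta>1" for n
  define y where "y n = z n - of_int (idx n) * pi" for n
  have sin_z: "\<bar>sin (z n)\<bar> \<le> (C + \<bar>H\<bar> * (1 + C)) / \<omega> n" if n: "ev n \<ge> 1" for n
  proof -
    have \<omega>1: "\<omega> n \<ge> 1" using n by (simp add: \<omega>_def)
    have b: "\<bar>u n b / r n - cos (\<omega> n * c - \<theta>0)\<bar> \<le> C / \<omega> n"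
      "\<bar>v n b / (r n * \<omega> n) + sin (\<omega> n * c - \<theta>0)\<bar> \<le> C / \<omega> n"
      using ru[OF n ends(2)] rv[OF n ends(2)] by (simp_all add: c_def)
    have CH: "(C + \<bar>H\<bar> * (1 + C)) / \<omega> n = C / \<omega> n + \<bar>H\<bar> * (1 + C) / \<omega> n"
      by (rule add_divide_distrib)
    show ?thesis
    proof (cases "\<theta>1 = 0")
      case True
      then have vb: "v n b = H * u n b" using bc_right[of n] by auto
      have "C / \<omega> n \<le> C" using \<omega>1 C0 by (simp add: divide_le_eq mult_left_mono[of 1 "\<omega> n" C, simplified])
      then have "\<bar>u n b / r n\<bar> \<le> 1 + C"
        using b(1) abs_cos_le_one[of "\<omega> n * c - \<theta>0"] by linarith
      then have "\<bar>H\<bar> * \<bar>u n b / r n\<bar> / \<omega> n \<le> \<bar>H\<bar> * (1 + C) / \<omega> n"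
        using \<omega>1 by (intro divide_right_mono mult_left_mono) auto
      moreover have "\<bar>H\<bar> * \<bar>u n b / r n\<bar> / \<omega> n = \<bar>v n b / (r n * \<omega> n)\<bar>"
        using \<omega>1 by (simp add: vb abs_mult)
      ultimately have "\<bar>v n b / (r n * \<omega> n)\<bar> \<le> \<bar>H\<bar> * (1 + C) / \<omega> n" by linarith
      moreover have "z n = \<omega> n * c - \<theta>0" using True by (simp add: z_def)
      ultimately show ?thesis unfolding CH using b(2) abs_triangle_ineq4[of "v n b / (r n * \<omega> n) + sin (\<omega> n * c - \<theta>0)" "v n b / (r n * \<omega> n)"] by (simp only: add_diff_cancel_left')
    next
      case False
      then have th: "\<theta>1 = pi / 2" and ub: "u n b = 0" using bc_right[of n] by auto
      have "sin (z n) = - cos (\<omega> n * c - \<theta>0)"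
        unfolding z_def th by (simp only: sin_diff[of _ "pi / 2"] sin_pi_half cos_pi_half mult_zero_right mult_1_right diff_0)
      moreover have "\<bar>H\<bar> * (1 + C) / \<omega> n \<ge> 0" using \<omega>1 C0 by simp
      ultimately show ?thesis using b(1) ub CH by simp
    qed
  qed
  have "(\<lambda>n. sin (z n)) \<longlonglongrightarrow> 0"
    by (rule Lim_null_comparison[OF _ over_\<omega>_tendsto_0])
      (use ev1 sin_z in \<open>auto elim!: eventually_mono\<close>)
  then have y0: "y \<longlonglongrightarrow> 0"
    unfolding y_def idx_def z_def[symmetric] by (rule nearest_multiple_of_pi)
  have \<omega>\<kappa>: "\<omega> n - \<kappa> (idx n) = y n / c" for n
    using c_pos by (simp add: y_def z_def \<kappa>_def field_simps)
  show ?thesis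
  proof (intro exI[of _ r] conjI allI impI)
    show "\<forall>\<^sub>F n in sequentially. r n \<noteq> 0" using ev1 by eventually_elim (rule r)
    show "(\<lambda>n. \<omega> n - \<kappa> (idx n)) \<longlonglongrightarrow> 0"
      unfolding \<omega>\<kappa> using tendsto_divide[OF y0 tendsto_const, of c] c_pos by simp
    fix \<epsilon> :: real assume "\<epsilon> > 0"
    have "(\<lambda>n. C / \<omega> n + \<bar>y n\<bar>) \<longlonglongrightarrow> 0 + \<bar>0\<bar>"
      by (intro tendsto_add over_\<omega>_tendsto_0 tendsto_rabs y0)
    then have "\<forall>\<^sub>F n in sequentially. C / \<omega> n + \<bar>y n\<bar> < \<epsilon>"
      using \<open>\<epsilon> > 0\<close> by (intro order_tendstoD) auto
    with ev1 show "\<forall>\<^sub>F n in sequentially. \<forall>x\<in>{a..b}. \<bar>u n x / r n - mode (idx n) x\<bar> \<le> \<epsilon>"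
    proof eventually_elim
      case (elim n)
      show ?case
      proof
        fix x assume x: "x \<in> {a..b}"
        have "\<bar>cos (\<omega> n * \<tau> x - \<theta>0) - mode (idx n) x\<bar> \<le> \<bar>(\<omega> n - \<kappa> (idx n)) * \<tau> x\<bar>"
          unfolding mode_def using cos_lipschitz[of "\<omega> n * \<tau> x - \<theta>0" "\<kappa> (idx n) * \<tau> x - \<theta>0"]
          by (simp add: left_diff_distrib)
        also have "\<dots> = \<bar>y n\<bar> * (\<tau> x / c)"
          using \<tau>_range[OF x] c_pos by (simp add: \<omega>\<kappa> abs_mult)
        also have "\<dots> \<le> \<bar>y n\<bar> * 1"
          using \<tau>_range[OF x] c_pos by (intro mult_left_mono) auto
        finally show "\<bar>u n x / r n - mode (idx n) x\<bar> \<le> \<epsilon>"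
          using ru[OF elim(1) x] elim(2) by linarith
      qed
    qed
  qed
qed

lemma ip_near_mode:
  assumes f: "continuous_on {a..b} f" and g: "continuous_on {a..b} g"
    and k: "\<kappa> k \<noteq> 0" and \<epsilon>: "\<epsilon> \<le> 1"
    and fm: "\<And>x. x \<in> {a..b} \<Longrightarrow> \<bar>f x - mode k x\<bar> \<le> \<epsilon>"
    and gm: "\<And>x. x \<in> {a..b} \<Longrightarrow> \<bar>g x - mode k x\<bar> \<le> \<epsilon>"
  shows "\<bar>ip f g - c / 2\<bar> \<le> 3 * \<epsilon> * c"
proof -
  have bd: "\<bar>f x * g x - mode k x * mode k x\<bar> \<le> 3 * \<epsilon>" if x: "x \<in> {a..b}" for x
  proof -
    have "\<bar>g x\<bar> \<le> 2" using gm[OF x] mode_le_1[of k x] \<epsilon> by linarith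
    then have "\<bar>f x - mode k x\<bar> * \<bar>g x\<bar> \<le> \<epsilon> * 2" using fm[OF x] by (intro mult_mono) auto
    moreover have "\<bar>mode k x\<bar> * \<bar>g x - mode k x\<bar> \<le> 1 * \<epsilon>"
      using gm[OF x] mode_le_1 by (intro mult_mono) auto
    moreover have "f x * g x - mode k x * mode k x
        = (f x - mode k x) * g x + mode k x * (g x - mode k x)" by (simp add: algebra_simps)
    ultimately show ?thesis unfolding abs_mult[symmetric] by linarith
  qed
  have "ip f g - c / 2 = integral {a..b} (\<lambda>x. (f x * g x - mode k x * mode k x) * \<sigma> x)"
    unfolding ip_mode[OF k, symmetric] ip_def left_diff_distrib
    by (intro integral_diff[symmetric] ip_integrable f g mode_cont)
  then show ?thesis
    by (auto intro!: weighted_integral_bound[OF _ bd] continuous_intros f g mode_cont)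
qed

lemma \<kappa>_idx_at_top: "filterlim (\<lambda>n. \<kappa> (idx n)) at_top sequentially"
proof -
  obtain r where "(\<lambda>n. \<omega> n - \<kappa> (idx n)) \<longlonglongrightarrow> 0"
    using mode_approximation by blast
  from tendsto_minus[OF this] have "(\<lambda>n. \<kappa> (idx n) - \<omega> n) \<longlonglongrightarrow> 0" by simp
  from filterlim_tendsto_add_at_top[OF this \<omega>_at_top] show ?thesis by simp
qed

text \<open>
  Two normalised eigenfunctions close to the same mode have inner product close to c / 2, which contradicts
  orthogonality.  Uniform closeness 1/12 leaves an error of at most c / 4.
\<close>

lemma idx_eventually_injective:
  "\<exists>N. \<forall>m\<ge>N. \<forall>n\<ge>N. idx m = idx n \<longrightarrow> m = n"
proof -
  obtain r where approx: "\<forall>\<epsilon>>0.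
      \<forall>\<^sub>F n in sequentially. \<forall>x\<in>{a..b}. \<bar>u n x / r n - mode (idx n) x\<bar> \<le> \<epsilon>"
    using mode_approximation by blast
  have "\<forall>\<^sub>F n in sequentially. (\<forall>x\<in>{a..b}. \<bar>u n x / r n - mode (idx n) x\<bar> \<le> 1 / 12)
      \<and> \<kappa> (idx n) > 0"
    using approx[rule_format, of "1 / 12"] \<kappa>_idx_at_top
    unfolding filterlim_at_top_dense by (intro eventually_conj) simp_all
  then obtain N where N: "\<And>n. n \<ge> N \<Longrightarrow> (\<forall>x\<in>{a..b}. \<bar>u n x / r n - mode (idx n) x\<bar> \<le> 1 / 12)
      \<and> \<kappa> (idx n) > 0"
    by (auto simp: eventually_sequentially)
  have "m = n" if mn: "m \<ge> N" "n \<ge> N" "idx m = idx n" for m n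
  proof (rule ccontr)
    assume "m \<noteq> n"
    have "\<bar>ip (\<lambda>x. u m x / r m) (\<lambda>x. u n x / r n) - c / 2\<bar> \<le> 3 * (1 / 12) * c"
    proof (rule ip_near_mode[where k = "idx m"])
      show "continuous_on {a..b} (\<lambda>x. u m x / r m)" "continuous_on {a..b} (\<lambda>x. u n x / r n)"
        unfolding divide_inverse by (intro continuous_on_mult_right u_cont)+
      show "\<kappa> (idx m) \<noteq> 0" using N[OF mn(1)] by simp
      fix x assume x: "x \<in> {a..b}"
      show "\<bar>u m x / r m - mode (idx m) x\<bar> \<le> 1 / 12" using N[OF mn(1)] x by blast
      show "\<bar>u n x / r n - mode (idx m) x\<bar> \<le> 1 / 12" using N[OF mn(2)] x mn(3) by simp
    qed simp
    moreover have "ip (\<lambda>x. u m x / r m) (\<lambda>x. u n x / r n)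
        = 1 / (r m * r n) * integral {a..b} (\<lambda>x. u m x * u n x * \<sigma> x)"
      unfolding ip_def integral_mult_right[symmetric] by (rule integral_cong) simp
    ultimately show False unfolding orthogonal[OF \<open>m \<noteq> n\<close>] using c_pos by simp
  qed
  then show ?thesis by blast
qed

text \<open>
  If the integer k = idx n + 1 were skipped, the eigenvalue near (\<kappa> k)^2 given by
  \<open>eigenvalue_near_\<kappa>_square\<close> would have an index strictly between n and n + 1.
\<close>

lemma idx_eventually_consecutive:
  "\<exists>N. \<forall>n\<ge>N. idx (Suc n) \<le> idx n + 1"
proof -
  obtain G k0 where G: "G > 0" "k0 \<ge> 1" "\<And>k. \<kappa> k \<ge> k0 \<Longrightarrow> \<exists>n. \<bar>ev n - (\<kappa> k)\<^sup>2\<bar> < G"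
    using eigenvalue_near_\<kappa>_square by blast
  have "\<forall>\<^sub>F n in sequentially. \<kappa> (idx n) \<ge> max k0 (max (G * c) (G + 1))"
    using \<kappa>_idx_at_top unfolding filterlim_at_top by blast
  then obtain N where N: "\<And>n. n \<ge> N \<Longrightarrow> \<kappa> (idx n) \<ge> max k0 (max (G * c) (G + 1))"
    by (auto simp: eventually_sequentially)
  have "idx (Suc n) \<le> idx n + 1" if n: "n \<ge> N" for n
  proof (rule ccontr)
    assume not: "\<not> ?thesis"
    define k where "k = idx n + 1"
    have \<kappa>k: "\<kappa> k \<ge> k0" "\<kappa> k \<ge> G * c" "\<kappa> k \<ge> 1" "\<kappa> k \<ge> G + 1"
      using N[OF n] \<kappa>_mono[of "idx n" k] G(2) by (auto simp: k_def)
    obtain m where m: "\<bar>ev m - (\<kappa> k)\<^sup>2\<bar> < G" using G(3)[OF \<kappa>k(1)] by blast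
    have "ev m > 0"
    proof -
      have "\<kappa> k * 1 \<le> \<kappa> k * \<kappa> k" using \<kappa>k(3) by (intro mult_left_mono) auto
      then show ?thesis using m \<kappa>k(4) unfolding power2_eq_square by linarith
    qed
    then have \<omega>2: "(\<omega> m)\<^sup>2 = ev m" and \<omega>0: "\<omega> m > 0" by (auto simp: \<omega>_def)
    have "\<bar>\<omega> m - \<kappa> k\<bar> * \<kappa> k \<le> \<bar>\<omega> m - \<kappa> k\<bar> * (\<omega> m + \<kappa> k)"
      using \<omega>0 by (intro mult_left_mono) auto
    also have "\<dots> = \<bar>(\<omega> m - \<kappa> k) * (\<omega> m + \<kappa> k)\<bar>"
      using \<omega>0 \<kappa>k(3) by (simp add: abs_mult)
    also have "\<dots> = \<bar>ev m - (\<kappa> k)\<^sup>2\<bar>" by (simp add: \<omega>2[symmetric] power2_eq_square algebra_simps)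
    also have "\<dots> < G" by (rule m)
    finally have "\<bar>\<omega> m - \<kappa> k\<bar> * \<kappa> k < G" .
    moreover have "\<bar>\<omega> m - \<kappa> k\<bar> * (G * c) \<le> \<bar>\<omega> m - \<kappa> k\<bar> * \<kappa> k"
      using \<kappa>k(2) by (intro mult_left_mono) auto
    moreover have "\<bar>\<omega> m - \<kappa> k\<bar> * (G * c) = G * (\<bar>\<omega> m - \<kappa> k\<bar> * c)"
      by (rule mult.left_commute)
    ultimately have "G * (\<bar>\<omega> m - \<kappa> k\<bar> * c) < G * 1" by linarith
    then have "\<bar>\<omega> m - \<kappa> k\<bar> * c < 1" using G(1) by (simp only: mult_less_cancel_left_pos)
    then have "\<bar>(\<omega> m - \<kappa> k) * c\<bar> < 1" using c_pos by (simp add: abs_mult)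
    then have "\<bar>(\<omega> m * c - \<theta>0 - \<theta>1) - of_int k * pi\<bar> < 1"
      using \<kappa>_right[of k] by (simp add: left_diff_distrib algebra_simps)
    also have "1 < pi / 2" using pi_gt3 by simp
    finally have "\<bar>((\<omega> m * c - \<theta>0 - \<theta>1) - of_int k * pi) / pi\<bar> < (pi / 2) / pi"
      unfolding abs_divide by (simp add: divide_strict_right_mono)
    then have "\<bar>(\<omega> m * c - \<theta>0 - \<theta>1) / pi - of_int k\<bar> < 1 / 2"
      by (simp add: diff_divide_distrib)
    then have "idx m = k" unfolding idx_def by (rule round_unique')
    then have "idx n < idx m" "idx m < idx (Suc n)" using not by (auto simp: k_def)
    then have "n < m" "m < Suc n" using idx_mono by (meson not_less)+
    then show False by simp
  qed
  then show ?thesis by blast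
qed

lemma idx_eventually_linear: "\<exists>N s. \<forall>n\<ge>N. idx n = int n + s"
proof -
  obtain N1 where N1: "\<And>m n. m \<ge> N1 \<Longrightarrow> n \<ge> N1 \<Longrightarrow> idx m = idx n \<Longrightarrow> m = n"
    using idx_eventually_injective by blast
  obtain N2 where N2: "\<And>n. n \<ge> N2 \<Longrightarrow> idx (Suc n) \<le> idx n + 1"
    using idx_eventually_consecutive by blast
  define N where "N = max N1 N2"
  have step: "idx (Suc n) = idx n + 1" if "n \<ge> N" for n
  proof -
    have "idx n \<noteq> idx (Suc n)" using N1[of n "Suc n"] that by (auto simp: N_def)
    then show ?thesis using N2[of n] idx_mono[of n "Suc n"] that by (auto simp: N_def)
  qed
  have "idx n = int n + (idx N - int N)" if "n \<ge> N" for n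
    using that by (induction n rule: dec_induct) (auto simp: step)
  then show ?thesis by blast
qed

section \<open>The spectral tail in Liouville normal form\<close>

lemma \<kappa>_shift: "\<kappa> (int n + s) * d + \<gamma> = real n * (pi * d / c) + (\<kappa> s * d + \<gamma>)"
  by (simp add: \<kappa>_def algebra_simps add_divide_distrib)

text \<open>
  The phase advances by \<pi> d / c in each step, and 0 < \<bar>d\<bar> < 2 c says that this is not a multiple of 2 \<pi>.
\<close>

lemma cesaro_phase:
  assumes "d \<noteq> 0" "\<bar>d\<bar> < 2 * c"
  shows "(\<lambda>N. (\<Sum>n<N. cos (\<kappa> (int n + s) * d + \<gamma>)) / real N) \<longlonglongrightarrow> 0"
proof -
  have "\<bar>pi * d / c / 2\<bar> = pi * (\<bar>d\<bar> / (2 * c))" using c_pos by (simp add: abs_mult)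
  also have "\<dots> < pi * 1" using assms c_pos by (intro mult_strict_left_mono) auto
  finally have lt: "\<bar>pi * d / c / 2\<bar> < pi" by simp
  have ne: "pi * d / c / 2 \<noteq> 0" using assms c_pos by simp
  have "sin (pi * d / c / 2) \<noteq> 0"
  proof (cases "pi * d / c / 2 > 0")
    case True
    then show ?thesis using sin_gt_zero[of "pi * d / c / 2"] lt by linarith
  next
    case False
    then show ?thesis using sin_gt_zero[of "- (pi * d / c / 2)"] lt ne
      by (simp only: sin_minus) linarith
  qed
  from cesaro_cos_arithmetic[OF this] show ?thesis unfolding \<kappa>_shift .
qed

lemma \<tau>_eq_iff: "x \<in> {a..b} \<Longrightarrow> y \<in> {a..b} \<Longrightarrow> \<tau> x = \<tau> y \<longleftrightarrow> x = y"
  using \<tau>_strict[of x y] \<tau>_strict[of y x] by (cases x y rule: linorder_cases) auto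

lemma cesaro_difference:
  assumes xy: "x \<in> {a..b}" "y \<in> {a..b}"
  shows "(\<lambda>N. (\<Sum>n<N. cos (\<kappa> (int n + s) * (\<tau> x - \<tau> y))) / real N) \<longlonglongrightarrow> of_bool (x = y)"
proof (cases "x = y")
  case True
  then show ?thesis using cesaro_const[of 1] by simp
next
  case False
  have "\<bar>\<tau> x - \<tau> y\<bar> < 2 * c" using \<tau>_range[OF xy(1)] \<tau>_range[OF xy(2)] c_pos by linarith
  then show ?thesis
    using cesaro_phase[of "\<tau> x - \<tau> y" s 0] False \<tau>_eq_iff[OF xy] by simp
qed

text \<open>
  The mean of cos (\<kappa> (\<tau> x + \<tau> y) - 2 \<theta>0).  The sum \<tau> x + \<tau> y lies in [0, 2 c], and resonance occurs
  exactly at the two ends of this range.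
\<close>

definition boundary_mean :: "real \<Rightarrow> real \<Rightarrow> real" where
  "boundary_mean x y =
    (if x = a \<and> y = a then cos (2 * \<theta>0) else if x = b \<and> y = b then cos (2 * \<theta>1) else 0)"

lemma cesaro_sum:
  assumes xy: "x \<in> {a..b}" "y \<in> {a..b}"
  shows "(\<lambda>N. (\<Sum>n<N. cos (\<kappa> (int n + s) * (\<tau> x + \<tau> y) - 2 * \<theta>0)) / real N) \<longlonglongrightarrow> boundary_mean x y"
proof -
  have \<tau>b: "\<tau> b = c" by (simp add: c_def)
  consider "x = a \<and> y = a" | "x = b \<and> y = b" | "\<not> (x = a \<and> y = a)" "\<not> (x = b \<and> y = b)" by blast
  then show ?thesis
  proof cases
    case 1
    then show ?thesis using cesaro_const[of "cos (2 * \<theta>0)"] by (simp add: \<tau>_left boundary_mean_def)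
  next
    case 2
    have "cos (\<kappa> k * (c + c) - 2 * \<theta>0) = cos (2 * \<theta>1)" for k
    proof -
      have "\<kappa> k * (c + c) - 2 * \<theta>0 = 2 * \<theta>1 + 2 * pi * of_int k"
        unfolding distrib_left \<kappa>_right by (simp add: algebra_simps)
      then show ?thesis by (simp add: cos_add)
    qed
    then show ?thesis using cesaro_const[of "cos (2 * \<theta>1)"] 2 ab
      by (simp add: \<tau>b boundary_mean_def)
  next
    case 3
    have "\<tau> x + \<tau> y \<noteq> 0"
      using 3(1) \<tau>_range(1)[OF xy(1)] \<tau>_range(1)[OF xy(2)] \<tau>_eq_iff[OF xy(1) ends(1)]
        \<tau>_eq_iff[OF xy(2) ends(1)] by (auto simp: \<tau>_left)
    moreover have "\<tau> x + \<tau> y \<noteq> 2 * c"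
      using 3(2) \<tau>_range(2)[OF xy(1)] \<tau>_range(2)[OF xy(2)] \<tau>_eq_iff[OF xy(1) ends(2)]
        \<tau>_eq_iff[OF xy(2) ends(2)] by (auto simp: \<tau>b)
    ultimately have "\<tau> x + \<tau> y \<noteq> 0" "\<bar>\<tau> x + \<tau> y\<bar> < 2 * c"
      using \<tau>_range[OF xy(1)] \<tau>_range[OF xy(2)] by linarith+
    moreover have "boundary_mean x y = 0" using 3 by (auto simp: boundary_mean_def)
    ultimately show ?thesis using cesaro_phase[of "\<tau> x + \<tau> y" s "- 2 * \<theta>0"] by simp
  qed
qed

lemma cesaro_mode_product:
  assumes xy: "x \<in> {a..b}" "y \<in> {a..b}"
  shows "(\<lambda>N. (\<Sum>n<N. mode (int n + s) x * mode (int n + s) y) / real N)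
    \<longlonglongrightarrow> (of_bool (x = y) + boundary_mean x y) / 2"
proof -
  have "mode k x * mode k y = cos (\<kappa> k * (\<tau> x - \<tau> y)) / 2 + cos (\<kappa> k * (\<tau> x + \<tau> y) - 2 * \<theta>0) / 2" for k
  proof -
    have "\<kappa> k * (\<tau> x - \<tau> y) = (\<kappa> k * \<tau> x - \<theta>0) - (\<kappa> k * \<tau> y - \<theta>0)"
      "\<kappa> k * (\<tau> x + \<tau> y) - 2 * \<theta>0 = (\<kappa> k * \<tau> x - \<theta>0) + (\<kappa> k * \<tau> y - \<theta>0)"
      by (simp_all add: algebra_simps)
    then show ?thesis unfolding mode_def cos_times_cos by (simp add: add_divide_distrib)
  qed
  then have means: "(\<Sum>n<N. mode (int n + s) x * mode (int n + s) y) / real N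
      = ((\<Sum>n<N. cos (\<kappa> (int n + s) * (\<tau> x - \<tau> y))) / real N
        + (\<Sum>n<N. cos (\<kappa> (int n + s) * (\<tau> x + \<tau> y) - 2 * \<theta>0)) / real N) / 2" for N
    by (simp add: sum.distrib add_divide_distrib flip: sum_divide_distrib)
  show ?thesis
    unfolding means by (intro tendsto_divide tendsto_add cesaro_difference cesaro_sum tendsto_const xy) simp
qed

text \<open>
  Multiplied by n^2, the terms differ by o(1) from 2 c / \<pi>^2 times a product of two modes: n^2 / ev n tends
  to c^2 / \<pi>^2, the squared norms of the normalised eigenfunctions tend to c / 2, and these eigenfunctions
  approach the modes.  The means of the products and \<open>cesaro_tail_limit\<close> give the limit.
\<close>

theorem spectral_tail:
  assumes xy: "x \<in> {a..b}" "y \<in> {a..b}"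
  defines "t \<equiv> \<lambda>n. u n x * u n y / (ev n * ip (u n) (u n))"
  shows "summable t"
    and "(\<lambda>N. real N * (\<Sum>k. t (N + 1 + k))) \<longlonglongrightarrow> c / pi\<^sup>2 * (of_bool (x = y) + boundary_mean x y)"
proof -
  obtain r where r: "\<forall>\<^sub>F n in sequentially. r n \<noteq> 0"
    and freq: "(\<lambda>n. \<omega> n - \<kappa> (idx n)) \<longlonglongrightarrow> 0"
    and approx: "\<forall>\<epsilon>>0. \<forall>\<^sub>F n in sequentially. \<forall>x\<in>{a..b}. \<bar>u n x / r n - mode (idx n) x\<bar> \<le> \<epsilon>"
    using mode_approximation by blast
  obtain N0 s where idx: "\<And>n. n \<ge> N0 \<Longrightarrow> idx n = int n + s" using idx_eventually_linear by blast
  have idx_ev: "\<forall>\<^sub>F n in sequentially. idx n = int n + s"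
    using eventually_ge_at_top[of N0] by eventually_elim (rule idx)
  define U where "U n x = u n x / r n" for n x
  have pointwise: "(\<lambda>n. U n z - mode (idx n) z) \<longlonglongrightarrow> 0" if z: "z \<in> {a..b}" for z
  proof (rule tendstoI)
    fix \<epsilon> :: real assume "\<epsilon> > 0"
    then have "\<forall>\<^sub>F n in sequentially. \<forall>x\<in>{a..b}. \<bar>u n x / r n - mode (idx n) x\<bar> \<le> \<epsilon> / 2"
      using approx[rule_format, of "\<epsilon> / 2"] by simp
    then show "\<forall>\<^sub>F n in sequentially. dist (U n z - mode (idx n) z) 0 < \<epsilon>"
      by eventually_elim (use z \<open>\<epsilon> > 0\<close> in \<open>fastforce simp: U_def\<close>)
  qed
  have norms: "(\<lambda>n. ip (U n) (U n)) \<longlonglongrightarrow> c / 2"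
  proof (rule LIM_zero_cancel, rule tendstoI)
    fix \<epsilon> :: real assume "\<epsilon> > 0"
    define \<delta> where "\<delta> = min 1 (\<epsilon> / (6 * c))"
    have \<delta>: "\<delta> > 0" "\<delta> \<le> 1" "3 * \<delta> * c < \<epsilon>"
    proof -
      show "\<delta> > 0" "\<delta> \<le> 1" using \<open>\<epsilon> > 0\<close> c_pos by (auto simp: \<delta>_def)
      have "3 * \<delta> * c \<le> 3 * (\<epsilon> / (6 * c)) * c"
        unfolding \<delta>_def using c_pos by (intro mult_right_mono mult_left_mono) auto
      also have "\<dots> < \<epsilon>" using c_pos \<open>\<epsilon> > 0\<close> by simp
      finally show "3 * \<delta> * c < \<epsilon>" .
    qed
    have "\<forall>\<^sub>F n in sequentially. \<forall>x\<in>{a..b}. \<bar>u n x / r n - mode (idx n) x\<bar> \<le> \<delta>"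
      using approx \<delta> by simp
    moreover have "\<forall>\<^sub>F n in sequentially. \<kappa> (idx n) > 0"
      using \<kappa>_idx_at_top unfolding filterlim_at_top_dense by blast
    ultimately show "\<forall>\<^sub>F n in sequentially. dist (ip (U n) (U n) - c / 2) 0 < \<epsilon>"
    proof eventually_elim
      case (elim n)
      have cont: "continuous_on {a..b} (U n)"
        unfolding U_def divide_inverse by (intro continuous_on_mult_right u_cont)
      have "\<bar>ip (U n) (U n) - c / 2\<bar> \<le> 3 * \<delta> * c"
      proof (rule ip_near_mode[OF cont cont])
        show "\<kappa> (idx n) \<noteq> 0" using elim by simp
      qed (use elim \<delta> in \<open>auto simp: U_def\<close>)
      then show ?case using \<delta> by simp
    qed
  qed
  have growth: "(\<lambda>n. (real n)\<^sup>2 / ev n) \<longlonglongrightarrow> c\<^sup>2 / pi\<^sup>2"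
  proof -
    have inv0: "(\<lambda>n. 1 / real n) \<longlonglongrightarrow> 0" by (rule lim_1_over_n)
    have "(\<lambda>n. (\<omega> n - \<kappa> (idx n)) * (1 / real n) + (pi / c + \<kappa> s * (1 / real n))) \<longlonglongrightarrow> 0 * 0 + (pi / c + \<kappa> s * 0)"
      by (intro tendsto_intros freq inv0)
    moreover have "\<forall>\<^sub>F n in sequentially.
        (\<omega> n - \<kappa> (idx n)) * (1 / real n) + (pi / c + \<kappa> s * (1 / real n)) = \<omega> n / real n"
      using idx_ev eventually_gt_at_top[of 0]
    proof eventually_elim
      case (elim n)
      have "\<kappa> (idx n) = real n * (pi / c) + \<kappa> s"
        using \<kappa>_shift[of n s 1 0] elim by simp
      then show ?case using elim by (simp add: field_simps)
    qed
    ultimately have "(\<lambda>n. \<omega> n / real n) \<longlonglongrightarrow> pi / c"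
      by (simp add: tendsto_cong)
    then have "(\<lambda>n. inverse ((\<omega> n / real n)\<^sup>2)) \<longlonglongrightarrow> inverse ((pi / c)\<^sup>2)"
      using c_pos by (intro tendsto_inverse tendsto_power) auto
    moreover have "\<forall>\<^sub>F n in sequentially. ev n \<ge> 1"
      using ev_at_top by (simp add: filterlim_at_top)
    then have "\<forall>\<^sub>F n in sequentially. inverse ((\<omega> n / real n)\<^sup>2) = (real n)\<^sup>2 / ev n"
      by eventually_elim (simp add: \<omega>_def power_divide)
    ultimately have "(\<lambda>n. (real n)\<^sup>2 / ev n) \<longlonglongrightarrow> inverse ((pi / c)\<^sup>2)"
      by (rule Lim_transform_eventually)
    then show ?thesis by (simp add: power_divide)
  qed
  define L where "L = 2 * c / pi\<^sup>2"
  define B where "B n = (real n)\<^sup>2 / ev n / ip (U n) (U n)" for n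
  have B: "B \<longlonglongrightarrow> L"
  proof -
    have "B \<longlonglongrightarrow> c\<^sup>2 / pi\<^sup>2 / (c / 2)"
      unfolding B_def using c_pos by (intro tendsto_divide growth norms) auto
    also have "c\<^sup>2 / pi\<^sup>2 / (c / 2) = L" using c_pos by (simp add: L_def power2_eq_square)
    finally show ?thesis .
  qed
  define M where "M n = mode (idx n) x * mode (idx n) y" for n
  have M_le: "\<bar>M n\<bar> \<le> 1" for n
    unfolding M_def abs_mult using mult_mono[OF mode_le_1 mode_le_1] by force
  have prod: "(\<lambda>n. U n x * U n y - M n) \<longlonglongrightarrow> 0"
  proof -
    have "(\<lambda>n. (U n x - mode (idx n) x) * (U n y - mode (idx n) y)
        + (mode (idx n) x * (U n y - mode (idx n) y) + mode (idx n) y * (U n x - mode (idx n) x)))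
      \<longlonglongrightarrow> 0 * 0 + (0 + 0)"
      by (intro tendsto_add tendsto_mult pointwise xy
          lim_null_mult_left_bounded[where B = 1] always_eventually)
        (simp_all add: mode_le_1)
    moreover have "(U n x - mode (idx n) x) * (U n y - mode (idx n) y)
        + (mode (idx n) x * (U n y - mode (idx n) y) + mode (idx n) y * (U n x - mode (idx n) x))
        = U n x * U n y - M n" for n
      by (simp add: M_def algebra_simps)
    ultimately show ?thesis by simp
  qed
  have "(\<lambda>n. (U n x * U n y - M n) * B n + M n * (B n - L)) \<longlonglongrightarrow> 0 * L + 0"
    by (intro tendsto_add tendsto_mult prod B lim_null_mult_left_bounded[where B = 1] always_eventually)
      (simp_all add: M_le LIM_zero[OF B])
  moreover have "\<forall>\<^sub>F n in sequentially. (U n x * U n y - M n) * B n + M n * (B n - L)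
      = t n * (real n)\<^sup>2 - L * (mode (int n + s) x * mode (int n + s) y)"
    using r idx_ev
  proof eventually_elim
    case (elim n)
    have "ip (U n) (U n) = integral {a..b} (\<lambda>x. 1 / (r n)\<^sup>2 * (u n x * u n x * \<sigma> x))"
      by (simp add: ip_def U_def power2_eq_square)
    also have "\<dots> = ip (u n) (u n) / (r n)\<^sup>2"
      unfolding integral_mult_right by (simp add: ip_def)
    finally have "t n * (real n)\<^sup>2 = U n x * U n y * B n"
      using elim by (simp add: t_def U_def B_def power2_eq_square)
    then show ?case using elim by (simp add: M_def algebra_simps)
  qed
  ultimately have t: "(\<lambda>n. t n * (real n)\<^sup>2 - L * (mode (int n + s) x * mode (int n + s) y)) \<longlonglongrightarrow> 0"
    by (simp add: tendsto_cong)
  have "(\<lambda>N. (\<Sum>n<N. L * (mode (int n + s) x * mode (int n + s) y)) / real N)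
      \<longlonglongrightarrow> L * ((of_bool (x = y) + boundary_mean x y) / 2)"
    using tendsto_mult[OF tendsto_const[of L] cesaro_mode_product[OF xy, of s]]
    by (simp add: sum_distrib_left)
  also have "L * ((of_bool (x = y) + boundary_mean x y) / 2) = c / pi\<^sup>2 * (of_bool (x = y) + boundary_mean x y)"
    by (simp add: L_def)
  finally have mean: "(\<lambda>N. (\<Sum>n<N. L * (mode (int n + s) x * mode (int n + s) y)) / real N)
      \<longlonglongrightarrow> c / pi\<^sup>2 * (of_bool (x = y) + boundary_mean x y)" .
  show "summable t" by (rule cesaro_tail_limit(1)[OF mean t])
  show "(\<lambda>N. real N * (\<Sum>k. t (N + 1 + k))) \<longlonglongrightarrow> c / pi\<^sup>2 * (of_bool (x = y) + boundary_mean x y)"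
    by (rule cesaro_tail_limit(2)[OF mean t])
qed

end

section \<open>The Liouville transformation\<close>

text \<open>
  The amplitude is \<rho> = (p w)^(1/4), and \<eta> is its derivative with respect to \<tau>, that is, \<rho>' / \<sigma> with
  \<sigma> = sqrt (w / p) = \<rho>^2 / p.  The potential contains the derivative of \<eta>; this is where p and w have to
  be twice continuously differentiable.
\<close>

lemma liouville_amplitude:
  fixes p w :: "real \<Rightarrow> real"
  assumes p: "C2_on {a..b} p" "\<forall>x\<in>{a..b}. p x > 0" and w: "C2_on {a..b} w" "\<forall>x\<in>{a..b}. w x > 0"
  obtains \<rho> \<eta> \<eta>' where "\<forall>x\<in>{a..b}. \<rho> x > 0" "\<forall>x\<in>{a..b}. (\<rho> x)^4 = p x * w x"
    "\<forall>x\<in>{a..b}. (\<rho> has_real_derivative \<eta> x * (\<rho> x)\<^sup>2 / p x) (at x within {a..b})"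
    "\<forall>x\<in>{a..b}. (\<eta> has_real_derivative \<eta>' x) (at x within {a..b})"
    "continuous_on {a..b} \<eta>'"
proof -
  obtain p' p'' where p': "\<And>x. x \<in> {a..b} \<Longrightarrow> (p has_real_derivative p' x) (at x within {a..b})"
    and p'': "\<And>x. x \<in> {a..b} \<Longrightarrow> (p' has_real_derivative p'' x) (at x within {a..b})"
    and cp'': "continuous_on {a..b} p''"
    using p(1) unfolding C2_on_def by blast
  obtain w' w'' where w': "\<And>x. x \<in> {a..b} \<Longrightarrow> (w has_real_derivative w' x) (at x within {a..b})"
    and w'': "\<And>x. x \<in> {a..b} \<Longrightarrow> (w' has_real_derivative w'' x) (at x within {a..b})"
    and cw'': "continuous_on {a..b} w''"
    using w(1) unfolding C2_on_def by blast
  define \<rho> where "\<rho> x = sqrt (sqrt (p x * w x))" for x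
  define \<rho>' where "\<rho>' x = (p' x * w x + p x * w' x) / (4 * \<rho> x ^ 3)" for x
  define \<eta> where "\<eta> x = (p' x * w x + p x * w' x) * p x / (4 * \<rho> x ^ 5)" for x
  define k where "k x = (p'' x * w x + 2 * (p' x * w' x) + p x * w'' x) * p x
      + (p' x * w x + p x * w' x) * p' x" for x
  define \<eta>' where "\<eta>' x = (k x * (4 * \<rho> x ^ 5)
      - (p' x * w x + p x * w' x) * p x * (20 * \<rho> x ^ 4 * \<rho>' x)) / (4 * \<rho> x ^ 5)\<^sup>2" for x
  have pw: "p x * w x > 0" if "x \<in> {a..b}" for x using p(2) w(2) that by simp
  have \<rho>_pos: "\<rho> x > 0" if "x \<in> {a..b}" for x using pw[OF that] by (simp add: \<rho>_def)
  have \<rho>2: "(\<rho> x)\<^sup>2 = sqrt (p x * w x)" if "x \<in> {a..b}" for x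
    using pw[OF that] by (simp add: \<rho>_def)
  have \<rho>4: "(\<rho> x)^4 = p x * w x" if "x \<in> {a..b}" for x
  proof -
    have "(\<rho> x)^4 = ((\<rho> x)\<^sup>2)\<^sup>2" by simp
    then show ?thesis using pw[OF that] by (simp add: \<rho>2[OF that])
  qed
  have \<rho>_deriv: "(\<rho> has_real_derivative \<rho>' x) (at x within {a..b})" if x: "x \<in> {a..b}" for x
  proof -
    have "(\<rho> has_real_derivative
        (p' x * w x + p x * w' x) * (inverse (sqrt (p x * w x)) / 2) * (inverse (\<rho> x) / 2)) (at x within {a..b})"
    proof -
      have 1: "((\<lambda>x. p x * w x) has_real_derivative p' x * w x + p x * w' x) (at x within {a..b})"
        by (rule derivative_eq_intros p' w' x refl)+ simp
      have 2: "(sqrt has_real_derivative inverse (sqrt (p x * w x)) / 2) (at (p x * w x))"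
        by (rule DERIV_real_sqrt[OF pw[OF x]])
      have 3: "(sqrt has_real_derivative inverse (\<rho> x) / 2) (at (sqrt (p x * w x)))"
        unfolding \<rho>_def using pw[OF x] by (intro DERIV_real_sqrt) simp
      show ?thesis
        using DERIV_chain2[OF 3 DERIV_chain2[OF 2 1]] unfolding \<rho>_def by (simp add: mult_ac)
    qed
    also have "(p' x * w x + p x * w' x) * (inverse (sqrt (p x * w x)) / 2) * (inverse (\<rho> x) / 2) = \<rho>' x"
      using \<rho>_pos[OF x] by (simp add: \<rho>'_def \<rho>2[OF x, symmetric] field_simps power2_eq_square power3_eq_cube)
    finally show ?thesis .
  qed
  have \<eta>_deriv: "(\<eta> has_real_derivative \<eta>' x) (at x within {a..b})" if x: "x \<in> {a..b}" for x
  proof -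
    have num: "((\<lambda>x. (p' x * w x + p x * w' x) * p x) has_real_derivative k x) (at x within {a..b})"
      unfolding k_def by (rule derivative_eq_intros p' w' p'' w'' x refl)+ (simp add: algebra_simps)
    have den: "((\<lambda>x. 4 * \<rho> x ^ 5) has_real_derivative 20 * \<rho> x ^ 4 * \<rho>' x) (at x within {a..b})"
      by (rule derivative_eq_intros \<rho>_deriv x refl)+ (simp add: algebra_simps)
    have "4 * \<rho> x ^ 5 \<noteq> 0" using \<rho>_pos[OF x] by simp
    from DERIV_divide[OF num den this] show ?thesis
      unfolding \<eta>_def \<eta>'_def by (simp add: power2_eq_square)
  qed
  have cont: "continuous_on {a..b} \<rho>" "continuous_on {a..b} p" "continuous_on {a..b} w"
    "continuous_on {a..b} p'" "continuous_on {a..b} w'"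
    using DERIV_continuous_on \<rho>_deriv p' w' p'' w'' by blast+
  have nz: "\<rho> x \<noteq> 0" if "x \<in> {a..b}" for x using \<rho>_pos[OF that] by simp
  have "continuous_on {a..b} \<eta>'"
    unfolding \<eta>'_def k_def \<rho>'_def
    by (intro continuous_intros cont cp'' cw'') (use nz in auto)
  moreover have "\<eta> x * (\<rho> x)\<^sup>2 / p x = \<rho>' x" if x: "x \<in> {a..b}" for x
  proof -
    have "\<rho> x ^ 5 = \<rho> x ^ 3 * (\<rho> x)\<^sup>2" by (simp flip: power_add)
    moreover have "X * P / (4 * (y * z)) * z / P = X / (4 * y)" if "P \<noteq> 0" "z \<noteq> 0" for X P y z :: real
      using that by simp
    ultimately show ?thesis
      unfolding \<eta>_def \<rho>'_def using \<rho>_pos[OF x] bspec[OF p(2) x] by (metis less_irrefl zero_less_power)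
  qed
  ultimately show ?thesis
    by (intro that[of \<rho> \<eta> \<eta>'] ballI) (simp_all add: \<rho>_pos \<rho>4 \<rho>_deriv \<eta>_deriv)
qed

lemma weighted_measure_integral:
  assumes w: "continuous_on {a..b} w" "\<forall>x\<in>{a..b}. w x > 0" and g: "continuous_on {a..b} g"
  shows "(\<integral>x. g x \<partial>weighted_measure a b w) = integral {a..b} (\<lambda>x. g x * w x)"
    and "integrable (weighted_measure a b w) g"
    and "g \<in> borel_measurable (weighted_measure a b w)"
proof -
  have meas: "f \<in> borel_measurable (lebesgue_on {a..b})" if "continuous_on {a..b} f" for f :: "real \<Rightarrow> real"
    using that by (intro continuous_imp_measurable_on_sets_lebesgue) auto
  have AE: "AE x in lebesgue_on {a..b}. 0 \<le> w x"
    using w(2) by (intro AE_I2) (auto simp: less_imp_le)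
  have int: "integrable (lebesgue_on {a..b}) (\<lambda>x. w x *\<^sub>R g x)"
    by (intro absolutely_integrable_imp_integrable absolutely_integrable_continuous_real)
      (auto intro!: continuous_intros w g)
  show "(\<integral>x. g x \<partial>weighted_measure a b w) = integral {a..b} (\<lambda>x. g x * w x)"
    unfolding weighted_measure_def integral_density[OF meas[OF g] meas[OF w(1)] AE]
    by (subst lebesgue_integral_eq_integral[OF int]) (auto simp: mult.commute)
  show "integrable (weighted_measure a b w) g"
    unfolding weighted_measure_def integrable_density[OF meas[OF g] meas[OF w(1)] AE] by (rule int)
  show "g \<in> borel_measurable (weighted_measure a b w)"
    using meas[OF g] by (simp add: weighted_measure_def)
qed

theorem theorem1p1:
  fixes a b \<alpha>1 \<alpha>2 \<beta>1 \<beta>2 :: real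
    and p q w :: "real \<Rightarrow> real"
    and \<phi> :: "nat \<Rightarrow> real \<Rightarrow> real"
    and ev :: "nat \<Rightarrow> real"
  assumes "a < b"
    and "continuous_on {a..b} q"
    and "C2_on {a..b} p" and "\<forall>x\<in>{a..b}. p x > 0"
    and "C2_on {a..b} w" and "\<forall>x\<in>{a..b}. w x > 0"
    and "\<alpha>1\<^sup>2 + \<alpha>2\<^sup>2 > 0" and "\<beta>1\<^sup>2 + \<beta>2\<^sup>2 > 0"
    and "\<forall>n. sl_eigenfunction a b p q w \<alpha>1 \<alpha>2 \<beta>1 \<beta>2 (ev n) (\<phi> n)"
    and "complete_orthogonal (weighted_measure a b w) \<phi>"
    and "strict_mono ev"
  shows "(\<forall>x\<in>{a..b}. \<forall>y\<in>{a..b}.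
            summable (\<lambda>n. \<phi> n x * \<phi> n y / (ev n * integral {a..b} (\<lambda>z. (\<phi> n z)\<^sup>2 * w z))))
    \<and> (\<forall>x\<in>{a<..<b}.
        (\<lambda>N. real N * (\<Sum>k. (\<phi> (N + 1 + k) x)\<^sup>2 /
            (ev (N + 1 + k) * integral {a..b} (\<lambda>z. (\<phi> (N + 1 + k) z)\<^sup>2 * w z))))
        \<longlonglongrightarrow> 1 / (pi\<^sup>2 * sqrt (p x * w x)) * integral {a..b} (\<lambda>z. sqrt (w z / p z)))
    \<and> (\<forall>x\<in>{a..b}. \<forall>y\<in>{a..b}. x \<noteq> y \<longrightarrow>
        (\<lambda>N. real N * (\<Sum>k. \<phi> (N + 1 + k) x * \<phi> (N + 1 + k) y /
            (ev (N + 1 + k) * integral {a..b} (\<lambda>z. (\<phi> (N + 1 + k) z)\<^sup>2 * w z))))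
        \<longlonglongrightarrow> 0)
    \<and> (\<lambda>N. real N * (\<Sum>k. (\<phi> (N + 1 + k) a)\<^sup>2 /
            (ev (N + 1 + k) * integral {a..b} (\<lambda>z. (\<phi> (N + 1 + k) z)\<^sup>2 * w z))))
        \<longlonglongrightarrow> (if \<alpha>2 \<noteq> 0
             then 2 / (pi\<^sup>2 * sqrt (p a * w a)) * integral {a..b} (\<lambda>z. sqrt (w z / p z))
             else 0)
    \<and> (\<lambda>N. real N * (\<Sum>k. (\<phi> (N + 1 + k) b)\<^sup>2 /
            (ev (N + 1 + k) * integral {a..b} (\<lambda>z. (\<phi> (N + 1 + k) z)\<^sup>2 * w z))))
        \<longlonglongrightarrow> (if \<beta>2 \<noteq> 0
             then 2 / (pi\<^sup>2 * sqrt (p b * w b)) * integral {a..b} (\<lambda>z. sqrt (w z / p z))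
             else 0)"
proof -
  note ab = assms(1) and q_cont = assms(2) and p_pos = assms(4) and w_pos = assms(6)
  note eig = assms(9) and complete = assms(10)
  have ends: "a \<in> {a..b}" "b \<in> {a..b}" using ab by auto
  obtain \<rho> \<eta> \<eta>' where \<rho>_pos: "\<forall>x\<in>{a..b}. \<rho> x > 0" and \<rho>4: "\<forall>x\<in>{a..b}. (\<rho> x)^4 = p x * w x"
    and \<rho>': "\<forall>x\<in>{a..b}. (\<rho> has_real_derivative \<eta> x * (\<rho> x)\<^sup>2 / p x) (at x within {a..b})"
    and \<eta>': "\<forall>x\<in>{a..b}. (\<eta> has_real_derivative \<eta>' x) (at x within {a..b})"
    and \<eta>'_cont: "continuous_on {a..b} \<eta>'"
    using liouville_amplitude[OF assms(3-6)] by blast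
  have "\<forall>n. \<exists>d. \<exists>\<psi>. (\<forall>x\<in>{a..b}. (\<phi> n has_real_derivative d x) (at x within {a..b})) \<and>
     (\<forall>x\<in>{a..b}. ((\<lambda>t. p t * d t) has_real_derivative \<psi> x) (at x within {a..b})) \<and>
     (\<forall>x\<in>{a..b}. \<psi> x - q x * \<phi> n x = - ev n * w x * \<phi> n x) \<and>
     \<alpha>1 * \<phi> n a + \<alpha>2 * d a = 0 \<and> \<beta>1 * \<phi> n b + \<beta>2 * d b = 0"
    using eig unfolding sl_eigenfunction_def sl_solution_def by blast
  from choice[OF this] obtain d where d: "\<forall>n. \<exists>\<psi>. (\<forall>x\<in>{a..b}. (\<phi> n has_real_derivative d n x) (at x within {a..b})) \<and>
     (\<forall>x\<in>{a..b}. ((\<lambda>t. p t * d n t) has_real_derivative \<psi> x) (at x within {a..b})) \<and>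
     (\<forall>x\<in>{a..b}. \<psi> x - q x * \<phi> n x = - ev n * w x * \<phi> n x) \<and>
     \<alpha>1 * \<phi> n a + \<alpha>2 * d n a = 0 \<and> \<beta>1 * \<phi> n b + \<beta>2 * d n b = 0"
    ..
  have \<phi>': "(\<phi> n has_real_derivative d n x) (at x within {a..b})" if "x \<in> {a..b}" for n x
    using d that by blast
  have p\<phi>': "((\<lambda>t. p t * d n t) has_real_derivative (q x - ev n * w x) * \<phi> n x) (at x within {a..b})"
    if x: "x \<in> {a..b}" for n x
  proof -
    obtain \<psi> where \<psi>: "((\<lambda>t. p t * d n t) has_real_derivative \<psi> x) (at x within {a..b})"
      "\<psi> x - q x * \<phi> n x = - ev n * w x * \<phi> n x"
      using d x by blast
    have "\<psi> x = (q x - ev n * w x) * \<phi> n x" using \<psi>(2) by (simp add: algebra_simps)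
    then show ?thesis using \<psi>(1) by simp
  qed
  have bc: "\<alpha>1 * \<phi> n a + \<alpha>2 * d n a = 0" "\<beta>1 * \<phi> n b + \<beta>2 * d n b = 0" for n
    using d by blast+
  obtain p' where "\<And>x. x \<in> {a..b} \<Longrightarrow> (p has_real_derivative p' x) (at x within {a..b})"
    using assms(3) unfolding C2_on_def by blast
  then have p_cont: "continuous_on {a..b} p" by (rule DERIV_continuous_on)
  obtain w' where "\<And>x. x \<in> {a..b} \<Longrightarrow> (w has_real_derivative w' x) (at x within {a..b})"
    using assms(5) unfolding C2_on_def by blast
  then have w_cont: "continuous_on {a..b} w" by (rule DERIV_continuous_on)
  have \<rho>_cont: "continuous_on {a..b} \<rho>" using \<rho>' by (intro DERIV_continuous_on) auto
  have \<phi>_cont: "continuous_on {a..b} (\<phi> n)" for n by (rule DERIV_continuous_on[OF \<phi>'])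
  have nz: "p x \<noteq> 0" "\<rho> x \<noteq> 0" "w x \<noteq> 0" if "x \<in> {a..b}" for x
    using p_pos \<rho>_pos w_pos that by force+
  have sqrt_pw: "sqrt (p x * w x) = (\<rho> x)\<^sup>2" if x: "x \<in> {a..b}" for x
  proof -
    have "p x * w x = ((\<rho> x)\<^sup>2)\<^sup>2" using \<rho>4 x by simp
    then show ?thesis by (simp only: real_sqrt_abs) simp
  qed
  define \<sigma> where "\<sigma> x = sqrt (w x / p x)" for x
  have \<sigma>_eq: "\<sigma> x = (\<rho> x)\<^sup>2 / p x" if x: "x \<in> {a..b}" for x
  proof -
    have "w x / p x = (p x * w x) / (p x)\<^sup>2" using nz[OF x] by (simp add: power2_eq_square)
    then have "\<sigma> x = sqrt (p x * w x) / \<bar>p x\<bar>" by (simp add: \<sigma>_def real_sqrt_divide)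
    then show ?thesis using sqrt_pw[OF x] bspec[OF p_pos x] by simp
  qed
  have w_eq: "w x = (\<rho> x)\<^sup>2 * \<sigma> x" if x: "x \<in> {a..b}" for x
    using \<rho>4 x nz[OF x] by (simp add: \<sigma>_eq[OF x] field_simps power2_eq_square power4_eq_xxxx)
  have \<sigma>_cont: "continuous_on {a..b} \<sigma>"
    unfolding \<sigma>_def using nz by (intro continuous_intros w_cont p_cont) auto
  define \<tau> where "\<tau> x = integral {a..x} \<sigma>" for x
  define R where "R x = \<eta>' x / \<rho> x + q x / (\<rho> x)\<^sup>2" for x
  define h where "h = (if \<alpha>2 = 0 then 0 else (\<eta> a - \<alpha>1 / \<alpha>2 * p a / \<rho> a) / \<rho> a)"
  define H where "H = (if \<beta>2 = 0 then 0 else (\<eta> b - \<beta>1 / \<beta>2 * p b / \<rho> b) / \<rho> b)"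
  define \<theta>0 where "\<theta>0 = (if \<alpha>2 = 0 then pi / 2 else 0)"
  define \<theta>1 where "\<theta>1 = (if \<beta>2 = 0 then pi / 2 else 0)"
  define u where "u n x = \<rho> x * \<phi> n x" for n x
  \<comment> \<open>this is u' / \<sigma>, written with p \<phi>', whose derivative the differential equation gives\<close>
  define v where "v n x = \<eta> x * \<phi> n x + p x * d n x / \<rho> x" for n x
  \<comment> \<open>for B \<noteq> 0 the condition A \<phi> + B \<phi>' = 0 becomes v = g u, for B = 0 it becomes u = 0\<close>
  have robin: "(if B = 0 then pi / 2 else 0 :: real) = 0 \<and> v n z = g * u n z
      \<or> (if B = 0 then pi / 2 else 0 :: real) = pi / 2 \<and> g = 0 \<and> u n z = 0"
    if "A\<^sup>2 + B\<^sup>2 > 0" "A * \<phi> n z + B * d n z = 0" "z \<in> {a..b}"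
      "g = (if B = 0 then 0 else (\<eta> z - A / B * p z / \<rho> z) / \<rho> z)" for A B n z g
  proof (cases "B = 0")
    case True
    then show ?thesis using that by (simp add: u_def)
  next
    case False
    then have "d n z = - (A / B) * \<phi> n z" using that(2) by (simp add: field_simps)
    then have "v n z = (\<eta> z - A / B * p z / \<rho> z) * \<phi> n z"
      by (simp add: v_def algebra_simps)
    also have "\<dots> = g * u n z"
      using that(4) False nz[OF that(3)] by (simp add: u_def)
    finally show ?thesis using False by simp
  qed
  have change: "f x * g x * w x = (\<rho> x * f x) * (\<rho> x * g x) * \<sigma> x" if "x \<in> {a..b}" for f g :: "real \<Rightarrow> real" and x
    by (simp add: w_eq[OF that] power2_eq_square)
  interpret liouville_form a b \<sigma> R \<tau> h H \<theta>0 \<theta>1 ev u v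
  proof
    show "a < b" by (rule ab)
    show "continuous_on {a..b} \<sigma>" by (rule \<sigma>_cont)
    show "\<sigma> x > 0" if "x \<in> {a..b}" for x using p_pos w_pos that by (simp add: \<sigma>_def)
    show "continuous_on {a..b} R"
      unfolding R_def using nz by (intro continuous_intros \<eta>'_cont \<rho>_cont q_cont) auto
    show "(\<tau> has_real_derivative \<sigma> x) (at x within {a..b})" if "x \<in> {a..b}" for x
      unfolding \<tau>_def by (rule integral_has_real_derivative[OF \<sigma>_cont that])
    show "\<tau> a = 0" by (simp add: \<tau>_def)
    show "(u n has_real_derivative \<sigma> x * v n x) (at x within {a..b})" if x: "x \<in> {a..b}" for n x
    proof -
      have "(u n has_real_derivative \<eta> x * (\<rho> x)\<^sup>2 / p x * \<phi> n x + d n x * \<rho> x) (at x within {a..b})"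
        unfolding u_def by (intro DERIV_mult \<phi>' x \<rho>'[rule_format])
      also have "\<eta> x * (\<rho> x)\<^sup>2 / p x * \<phi> n x + d n x * \<rho> x = \<sigma> x * v n x"
        using nz[OF x] by (simp add: \<sigma>_eq[OF x] v_def field_simps power2_eq_square)
      finally show ?thesis .
    qed
    show "(v n has_real_derivative (R x - ev n * \<sigma> x) * u n x) (at x within {a..b})"
      if x: "x \<in> {a..b}" for n x
    proof -
      have "(v n has_real_derivative (\<eta>' x * \<phi> n x + d n x * \<eta> x)
          + ((q x - ev n * w x) * \<phi> n x * \<rho> x - p x * d n x * (\<eta> x * (\<rho> x)\<^sup>2 / p x)) / (\<rho> x * \<rho> x)) (at x within {a..b})"
        unfolding v_def by (intro DERIV_add DERIV_mult DERIV_divide \<phi>' p\<phi>' x \<eta>'[rule_format] \<rho>'[rule_format] nz)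
      also have "(\<eta>' x * \<phi> n x + d n x * \<eta> x)
          + ((q x - ev n * w x) * \<phi> n x * \<rho> x - p x * d n x * (\<eta> x * (\<rho> x)\<^sup>2 / p x)) / (\<rho> x * \<rho> x)
          = (R x - ev n * \<sigma> x) * u n x"
        using nz[OF x] by (simp add: w_eq[OF x] R_def u_def field_simps power2_eq_square)
      finally show ?thesis .
    qed
    show "\<theta>0 = 0 \<and> v n a = h * u n a \<or> \<theta>0 = pi / 2 \<and> h = 0 \<and> u n a = 0" for n
      unfolding \<theta>0_def by (rule robin[OF assms(7) bc(1) ends(1) h_def])
    show "\<theta>1 = 0 \<and> v n b = H * u n b \<or> \<theta>1 = pi / 2 \<and> H = 0 \<and> u n b = 0" for n
      unfolding \<theta>1_def by (rule robin[OF assms(8) bc(2) ends(2) H_def])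
    show "\<exists>x\<in>{a..b}. u n x \<noteq> 0" for n
      using eig nz unfolding sl_eigenfunction_def u_def by (metis mult_eq_0_iff)
    show "strict_mono ev" by (rule assms(11))
    show "integral {a..b} (\<lambda>x. u m x * u n x * \<sigma> x) = 0" if "m \<noteq> n" for m n
    proof -
      have "integral {a..b} (\<lambda>x. u m x * u n x * \<sigma> x) = integral {a..b} (\<lambda>x. \<phi> m x * \<phi> n x * w x)"
        by (intro integral_cong) (simp add: change u_def)
      also have "\<dots> = (\<integral>x. \<phi> m x * \<phi> n x \<partial>weighted_measure a b w)"
        by (intro weighted_measure_integral(1)[symmetric] w_cont w_pos continuous_intros \<phi>_cont)
      also have "\<dots> = 0" using complete that by (simp add: complete_orthogonal_def)
      finally show ?thesis .
    qed
    show "\<exists>K c. integral {a..b} (\<lambda>x. (f x - (\<Sum>n<K. c n * u n x))\<^sup>2 * \<sigma> x) < e"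
      if f: "continuous_on {a..b} f" and e: "e > 0" for f e
    proof -
      \<comment> \<open>multiplication by \<rho> is an isometry from the weight w to the weight \<sigma>\<close>
      define g where "g x = f x / \<rho> x" for x
      have g: "continuous_on {a..b} g"
        unfolding g_def using nz by (intro continuous_intros f \<rho>_cont) auto
      have "g \<in> L2_space (weighted_measure a b w)"
        unfolding L2_space_def
        by (auto intro!: weighted_measure_integral(2,3) w_cont w_pos continuous_intros g)
      then obtain K c where Kc: "sqrt (\<integral>x. (g x - (\<Sum>n<K. c n * \<phi> n x))\<^sup>2 \<partial>weighted_measure a b w) < sqrt e"
        using complete e unfolding complete_orthogonal_def by (meson real_sqrt_gt_zero)
      have "(\<integral>x. (g x - (\<Sum>n<K. c n * \<phi> n x))\<^sup>2 \<partial>weighted_measure a b w)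
          = integral {a..b} (\<lambda>x. (g x - (\<Sum>n<K. c n * \<phi> n x))\<^sup>2 * w x)"
        by (intro weighted_measure_integral(1) w_cont w_pos continuous_intros g \<phi>_cont)
      also have "\<dots> = integral {a..b} (\<lambda>x. (f x - (\<Sum>n<K. c n * u n x))\<^sup>2 * \<sigma> x)"
      proof (rule integral_cong)
        fix x assume x: "x \<in> {a..b}"
        have "\<rho> x * (g x - (\<Sum>n<K. c n * \<phi> n x)) = f x - (\<Sum>n<K. c n * u n x)"
          using nz[OF x] by (simp add: g_def u_def right_diff_distrib sum_distrib_left mult_ac)
        then show "(g x - (\<Sum>n<K. c n * \<phi> n x))\<^sup>2 * w x = (f x - (\<Sum>n<K. c n * u n x))\<^sup>2 * \<sigma> x"
          using change[OF x, of "\<lambda>x. g x - (\<Sum>n<K. c n * \<phi> n x)" "\<lambda>x. g x - (\<Sum>n<K. c n * \<phi> n x)"]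
          by (simp add: power2_eq_square)
      qed
      finally show ?thesis using Kc by auto
    qed
  qed
  define I where "I = integral {a..b} (\<lambda>z. sqrt (w z / p z))"
  have c_I: "c = I" by (simp add: c_def \<tau>_def I_def \<sigma>_def[abs_def])
  have norm: "integral {a..b} (\<lambda>z. (\<phi> n z)\<^sup>2 * w z) = ip (u n) (u n)" for n
    unfolding ip_def by (intro integral_cong) (simp add: change u_def power2_eq_square)
  have summand: "\<phi> n x * \<phi> n y / (ev n * integral {a..b} (\<lambda>z. (\<phi> n z)\<^sup>2 * w z))
      = 1 / (\<rho> x * \<rho> y) * (u n x * u n y / (ev n * ip (u n) (u n)))"
    if "x \<in> {a..b}" "y \<in> {a..b}" for x y n
    using nz[OF that(1)] nz[OF that(2)] by (simp add: norm u_def)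
  have summ: "summable (\<lambda>n. \<phi> n x * \<phi> n y / (ev n * integral {a..b} (\<lambda>z. (\<phi> n z)\<^sup>2 * w z)))"
    if "x \<in> {a..b}" "y \<in> {a..b}" for x y
    unfolding summand[OF that] by (intro summable_mult spectral_tail(1)[OF that])
  have lim: "(\<lambda>N. real N * (\<Sum>k. \<phi> (N + 1 + k) x * \<phi> (N + 1 + k) y /
            (ev (N + 1 + k) * integral {a..b} (\<lambda>z. (\<phi> (N + 1 + k) z)\<^sup>2 * w z))))
      \<longlonglongrightarrow> 1 / (\<rho> x * \<rho> y) * (I / pi\<^sup>2 * (of_bool (x = y) + boundary_mean x y))"
    if xy: "x \<in> {a..b}" "y \<in> {a..b}" for x y
  proof -
    have "(\<Sum>k. \<phi> (N + 1 + k) x * \<phi> (N + 1 + k) y /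
            (ev (N + 1 + k) * integral {a..b} (\<lambda>z. (\<phi> (N + 1 + k) z)\<^sup>2 * w z)))
        = 1 / (\<rho> x * \<rho> y) * (\<Sum>k. u (N + 1 + k) x * u (N + 1 + k) y
            / (ev (N + 1 + k) * ip (u (N + 1 + k)) (u (N + 1 + k))))" for N
    proof -
      have "summable (\<lambda>k. u (k + (N + 1)) x * u (k + (N + 1)) y
            / (ev (k + (N + 1)) * ip (u (k + (N + 1))) (u (k + (N + 1)))))"
        using spectral_tail(1)[OF xy] by (rule summable_ignore_initial_segment)
      then show ?thesis
        unfolding summand[OF xy] by (intro suminf_mult) (simp add: add.commute)
    qed
    then show ?thesis
      using tendsto_mult[OF tendsto_const[of "1 / (\<rho> x * \<rho> y)"] spectral_tail(2)[OF xy]]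
      by (simp add: c_I mult.left_commute)
  qed
  have diag: "(\<lambda>N. real N * (\<Sum>k. (\<phi> (N + 1 + k) x)\<^sup>2 /
            (ev (N + 1 + k) * integral {a..b} (\<lambda>z. (\<phi> (N + 1 + k) z)\<^sup>2 * w z))))
      \<longlonglongrightarrow> (1 + boundary_mean x x) / (pi\<^sup>2 * sqrt (p x * w x)) * I" if x: "x \<in> {a..b}" for x
  proof -
    have "1 / (\<rho> x * \<rho> x) * (I / pi\<^sup>2 * (of_bool (x = x) + boundary_mean x x))
        = (1 + boundary_mean x x) / (pi\<^sup>2 * sqrt (p x * w x)) * I"
      by (simp add: sqrt_pw[OF x] power2_eq_square mult_ac)
    then show ?thesis using lim[OF x x] by (simp only: power2_eq_square[of "\<phi> _ x"])
  qed
  have bm: "boundary_mean x x = 0" if "x \<in> {a<..<b}" for x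
    using that by (simp add: boundary_mean_def)
  have bm0: "boundary_mean x y = 0" if "x \<noteq> y" for x y
    using that by (auto simp: boundary_mean_def)
  have cos_left: "cos (2 * \<theta>0) = (if \<alpha>2 \<noteq> 0 then 1 else - 1)"
    unfolding \<theta>0_def by simp
  have cos_right: "cos (2 * \<theta>1) = (if \<beta>2 \<noteq> 0 then 1 else - 1)"
    unfolding \<theta>1_def by simp
  have bma: "boundary_mean a a = (if \<alpha>2 \<noteq> 0 then 1 else - 1)"
    using cos_left by (simp add: boundary_mean_def)
  have bmb: "boundary_mean b b = (if \<beta>2 \<noteq> 0 then 1 else - 1)"
    using cos_right ab by (simp add: boundary_mean_def)
  show ?thesis
    unfolding I_def[symmetric]
  proof (intro conjI ballI impI)
    fix x y assume "x \<in> {a..b}" "y \<in> {a..b}"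
    then show "summable (\<lambda>n. \<phi> n x * \<phi> n y / (ev n * integral {a..b} (\<lambda>z. (\<phi> n z)\<^sup>2 * w z)))"
      by (rule summ)
  next
    fix x assume "x \<in> {a<..<b}"
    then show "(\<lambda>N. real N * (\<Sum>k. (\<phi> (N + 1 + k) x)\<^sup>2 /
            (ev (N + 1 + k) * integral {a..b} (\<lambda>z. (\<phi> (N + 1 + k) z)\<^sup>2 * w z))))
        \<longlonglongrightarrow> 1 / (pi\<^sup>2 * sqrt (p x * w x)) * I"
      using diag[of x] bm[of x] by simp
  next
    fix x y assume "x \<in> {a..b}" "y \<in> {a..b}" "x \<noteq> y"
    then show "(\<lambda>N. real N * (\<Sum>k. \<phi> (N + 1 + k) x * \<phi> (N + 1 + k) y /
            (ev (N + 1 + k) * integral {a..b} (\<lambda>z. (\<phi> (N + 1 + k) z)\<^sup>2 * w z)))) \<longlonglongrightarrow> 0"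
      using lim[of x y] bm0[of x y] by simp
  next
    show "(\<lambda>N. real N * (\<Sum>k. (\<phi> (N + 1 + k) a)\<^sup>2 /
            (ev (N + 1 + k) * integral {a..b} (\<lambda>z. (\<phi> (N + 1 + k) z)\<^sup>2 * w z))))
        \<longlonglongrightarrow> (if \<alpha>2 \<noteq> 0 then 2 / (pi\<^sup>2 * sqrt (p a * w a)) * I else 0)"
      using diag[OF ends(1)] unfolding bma by (simp split: if_splits)
    show "(\<lambda>N. real N * (\<Sum>k. (\<phi> (N + 1 + k) b)\<^sup>2 /
            (ev (N + 1 + k) * integral {a..b} (\<lambda>z. (\<phi> (N + 1 + k) z)\<^sup>2 * w z))))
        \<longlonglongrightarrow> (if \<beta>2 \<noteq> 0 then 2 / (pi\<^sup>2 * sqrt (p b * w b)) * I else 0)"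
      using diag[OF ends(2)] unfolding bmb by (simp split: if_splits)
  qed
qed

end
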